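(* Suppose there exist symmetric positive-definite matrices $P(1),\dots,P(D)\in\mathbb{S}^n_+$ such that $$P(i)A(i)+A(i)^{\top}P(i)+\sum_{j=1}^{D}\pi_{ij}P(j)<0,\qquad i\in\mathcal{S},$$ and suppose $b\in L^2_{\mathbb{F}}(\mathbb{R}^n)$. Then for every $(x,i)\in\mathbb{R}^n\times\mathcal{S}$ the system $$\dot X(t)=A(\alpha_t)X(t)+b(t),\quad t\ge 0,\qquad X(0)=x,\quad \alpha_0=i,$$ admits a unique solution $X\in L^2_{\mathbb{F}}(\mathbb{R}^n)$.
   Context: $(\Omega,\mathcal{F},\mathbb{F},\mathbb{P})$ is a complete filtered probability space carrying a continuous-time, irreducible Markov chain $\alpha$ with finite state space $\mathcal{S}=\{1,\dots,D\}$ and generator $\mathbf{\Pi}=(\pi_{ij})_{i,j\in\mathcal{S}}$, where $\pi_{ij}\ge 0$ for $i\ne j$ and $\pi_{ii}=-\sum_{j\neq i}\pi_{ij}$; $\mathbb{F}=\{\mathcal{F}_t\}_{t\ge0}$ is the natural filtration of $\alpha$ augmented by the $\mathbb{P}$-null sets. When an initial state $i$ is given, the chain starts from $\alpha_0=i$. For each $i\in\mathcal{S}$, $A(i)\in\mathbb{R}^{n\times n}$ is a given constant matrix, and $A(\alpha_t)=\sum_{i=1}^D A(i)\mathbb{I}_{\{\alpha_t=i\}}$. $L^2_{\mathbb{F}}(\mathbb{R}^n)$ is the set of $\mathbb{R}^n$-valued $\mathbb{F}$-progressively measurable processes $\varphi$ with $\mathbb{E}\int_0^\infty|\varphi(s)|^2ds<\infty$.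 $\mathbb{S}^n_+$ is the set of symmetric positive-definite $n\times n$ matrices; $M<0$ means that $-M$ is positive definite. *)

theory Defs
  imports "HOL-Probability.Probability"
begin

definition pos_def :: "real^'n^'n \<Rightarrow> bool" where
  "pos_def M \<longleftrightarrow> transpose M = M \<and> (\<forall>v. v \<noteq> 0 \<longrightarrow> 0 < v \<bullet> (M *v v))"

definition neg_def :: "real^'n^'n \<Rightarrow> bool" where
  "neg_def M \<longleftrightarrow> pos_def (- M)"

text \<open>The finite state space is a finite type, and a matrix indexed by states is an element of
  \<open>real^'s^'s\<close>, with \<open>Q $ i $ j\<close> the entry for the transition from \<open>i\<close> to \<open>j\<close>. Time ranges
  over the non-negative reals; values at negative times are never used.\<close>

definition q_matrix :: "real^'s^'s \<Rightarrow> bool" where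
  "q_matrix Q \<longleftrightarrow>
     (\<forall>i j. i \<noteq> j \<longrightarrow> 0 \<le> Q $ i $ j) \<and> (\<forall>i. Q $ i $ i = - (\<Sum>j\<in>UNIV - {i}. Q $ i $ j))"

definition transition_semigroup :: "(real \<Rightarrow> real^'s^'s) \<Rightarrow> bool" where
  "transition_semigroup p \<longleftrightarrow>
     (\<forall>t\<ge>0. \<forall>i j. 0 \<le> p t $ i $ j) \<and>
     (\<forall>t\<ge>0. \<forall>i. (\<Sum>j\<in>UNIV. p t $ i $ j) = 1) \<and>
     p 0 = mat 1 \<and>
     (\<forall>s\<ge>0. \<forall>t\<ge>0. p (s + t) = p s ** p t)"

definition has_generator :: "(real \<Rightarrow> real^'s^'s) \<Rightarrow> real^'s^'s \<Rightarrow> bool" where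
  "has_generator p Q \<longleftrightarrow> ((\<lambda>h. (p h - mat 1) /\<^sub>R h) \<longlongrightarrow> Q) (at_right 0)"

definition irreducible_semigroup :: "(real \<Rightarrow> real^'s^'s) \<Rightarrow> bool" where
  "irreducible_semigroup p \<longleftrightarrow> (\<forall>i j. \<exists>t\<ge>0. 0 < p t $ i $ j)"

text \<open>Right-continuity with left limits, for the discrete topology on the state space.\<close>

definition cadlag_path :: "(real \<Rightarrow> 's) \<Rightarrow> bool" where
  "cadlag_path a \<longleftrightarrow>
     (\<forall>t\<ge>0. \<forall>\<^sub>F s in at_right t. a s = a t) \<and>
     (\<forall>t>0. \<exists>j. \<forall>\<^sub>F s in at_left t. a s = j)"

definition augmented_filtration :: "'w measure \<Rightarrow> (real \<Rightarrow> 'w \<Rightarrow> 's) \<Rightarrow> real \<Rightarrow> 'w measure" where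
  "augmented_filtration M \<alpha> t =
     sigma (space M) ({\<alpha> s -` B \<inter> space M | s B. 0 \<le> s \<and> s \<le> t} \<union> null_sets M)"

text \<open>Markov property relative to the filtration \<open>F\<close>; the initial law is left unspecified.\<close>

definition markov_chain ::
    "'w measure \<Rightarrow> (real \<Rightarrow> 'w measure) \<Rightarrow> (real \<Rightarrow> 'w \<Rightarrow> 's::finite) \<Rightarrow> (real \<Rightarrow> real^'s^'s) \<Rightarrow> bool"
  where
  "markov_chain M F \<alpha> p \<longleftrightarrow>
     transition_semigroup p \<and>
     (\<forall>t\<ge>0. \<alpha> t \<in> measurable M (count_space UNIV)) \<and>
     (AE \<omega> in M. cadlag_path (\<lambda>t. \<alpha> t \<omega>)) \<and>
     (\<forall>s t j. 0 \<le> s \<and> s \<le> t \<longrightarrow>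
        (AE \<omega> in M. real_cond_exp M (F s) (indicator {\<omega> \<in> space M. \<alpha> t \<omega> = j}) \<omega>
                     = p (t - s) $ \<alpha> s \<omega> $ j))"

definition progressively_measurable ::
    "(real \<Rightarrow> 'w measure) \<Rightarrow> (real \<Rightarrow> 'w \<Rightarrow> 'b::topological_space) \<Rightarrow> bool" where
  "progressively_measurable F \<phi> \<longleftrightarrow>
     (\<forall>t\<ge>0. (\<lambda>(s, \<omega>). \<phi> s \<omega>) \<in> borel_measurable (restrict_space borel {0..t} \<Otimes>\<^sub>M F t))"

definition L2_F ::
    "'w measure \<Rightarrow> (real \<Rightarrow> 'w measure) \<Rightarrow> (real \<Rightarrow> 'w \<Rightarrow> 'b::real_normed_vector) set" where
  "L2_F M F = {\<phi>. progressively_measurable F \<phi> \<and>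
     (\<integral>\<^sup>+\<omega>. (\<integral>\<^sup>+s\<in>{0..}. ennreal ((norm (\<phi> s \<omega>))\<^sup>2) \<partial>lborel) \<partial>M) < \<infinity>}"

text \<open>Since \<open>b\<close> is only square-integrable in time, the differential equation is understood
  almost surely and in the sense of Caratheodory, i.e. in integrated form. The case \<open>t = 0\<close> is the
  initial condition \<open>X 0 = x\<close>.\<close>

definition solves_system ::
    "'w measure \<Rightarrow> (real \<Rightarrow> 'w \<Rightarrow> 's) \<Rightarrow> ('s \<Rightarrow> real^'n^'n) \<Rightarrow> (real \<Rightarrow> 'w \<Rightarrow> real^'n) \<Rightarrow> real^'n
      \<Rightarrow> (real \<Rightarrow> 'w \<Rightarrow> real^'n) \<Rightarrow> bool" where
  "solves_system M \<alpha> A b x X \<longleftrightarrow>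
     (AE \<omega> in M. \<forall>t\<ge>0.
        set_integrable lborel {0..t} (\<lambda>s. A (\<alpha> s \<omega>) *v X s \<omega> + b s \<omega>) \<and>
        X t \<omega> = x + (LINT s:{0..t}|lborel. A (\<alpha> s \<omega>) *v X s \<omega> + b s \<omega>))"

end

theory Submission
  imports Defs
begin

text \<open>Path by path, the Picard iterates converge, which gives a progressively measurable solution and its
  uniqueness. Square integrability comes from a discrete-time Lyapunov argument instead of the Ito
  formula. Put \<open>V(t) = E \<langle>P(\<alpha>\<^sub>t) X\<^sub>t, X\<^sub>t\<rangle>\<close>. Conditioning on the past at time \<open>t\<close> and using
  \<open>p(h) = 1 + h Q + o(h)\<close>, the matrix inequality yields
  \<open>V(t + h) \<le> V(t) - (\<delta>/2) h E|X\<^sub>t|\<^sup>2 + C \<beta>\<close> for one fixed small step \<open>h\<close>,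
  where \<open>\<beta>\<close> is the expected energy of \<open>b\<close> on \<open>[t, t + h]\<close>. Telescoping along
  the grid \<open>k h\<close> bounds the sum of \<open>E|X\<^sub>k\<^sub>h|\<^sup>2\<close>, and on each grid cell \<open>|X|\<^sup>2\<close> is controlled by its value
  at the left end point and the energy of \<open>b\<close>.\<close>

section \<open>Caratheodory differential equations\<close>

text \<open>The errors of one step differ in how they become small. Errors caused by a jump need a
  jump, of probability of order \<open>h\<close>, and act for a time of order \<open>h\<close>; the
  second-order terms of the expansion are of order \<open>h\<^sup>2\<close> as well. The generator
  error is \<open>e * h\<close>, and separating \<open>X\<close> from the noise costs a term
  \<open>\<epsilon> * h\<close>. Hence \<open>\<epsilon>\<close> and \<open>e\<close> are fixed
  first, as fractions of \<delta>, and \<open>h\<close> afterwards; no limit in \<open>h\<close> is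
  taken. The noise is the delicate term: it enters linearly through its L1 norm \<open>B\<close>
  over the step. Cauchy-Schwarz in time, \<open>B\<^sup>2 \<le> h * \<beta>\<close>, supplies the
  factor \<open>h\<close> that cancels the one lost in Young's inequality, so the energy coefficient
  stays bounded. Nonnegativity of \<open>V\<close>, from positive definiteness, closes the
  telescoping sum. A second obstacle: regular paths of the chain and finite energy of the paths of
  \<open>b\<close> are only almost sure. Both processes are changed on one null set, which belongs
  to every \<sigma>-algebra of the augmented filtration, so pathwise arguments hold for every
  \<omega> and adaptedness survives.\<close>

lemma set_lborel_integral_combine:
  fixes g :: "real \<Rightarrow> 'e::euclidean_space"
  assumes "set_integrable lborel {a..b} g" "a \<le> c" "c \<le> b"
  shows "(LINT s:{a..b}|lborel. g s) = (LINT s:{a..c}|lborel. g s) + (LINT s:{c..b}|lborel. g s)"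
proof -
  have 1: "set_integrable lborel {a..c} g" "set_integrable lborel {c..b} g"
    using assms by (auto intro: set_integrable_subset)
  show ?thesis
    using Henstock_Kurzweil_Integration.integral_combine[OF assms(2,3), of g]
      set_borel_integral_eq_integral[OF assms(1)]
      set_borel_integral_eq_integral[OF 1(1)] set_borel_integral_eq_integral[OF 1(2)]
    by simp
qed

lemma continuous_on_set_lborel_integral:
  fixes g :: "real \<Rightarrow> 'e::euclidean_space"
  assumes "set_integrable lborel {a..b} g"
  shows "continuous_on {a..b} (\<lambda>t. LINT s:{a..t}|lborel. g s)"
proof -
  have "continuous_on {a..b} (\<lambda>t. integral {a..t} g)"
    using set_borel_integral_eq_integral(1)[OF assms] by (rule indefinite_integral_continuous_1)
  moreover have "(LINT s:{a..t}|lborel. g s) = integral {a..t} g" if "t \<in> {a..b}" for t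
    using that by (intro set_borel_integral_eq_integral(2) set_integrable_subset[OF assms]) auto
  ultimately show ?thesis by (elim continuous_on_eq) simp
qed

lemma norm_set_lborel_integral_le:
  fixes g :: "real \<Rightarrow> 'e::euclidean_space"
  assumes "set_integrable lborel {a..b} g" "set_integrable lborel {a..b} k"
    and "\<And>s. a \<le> s \<Longrightarrow> s \<le> b \<Longrightarrow> norm (g s) \<le> k s"
  shows "norm (LINT s:{a..b}|lborel. g s) \<le> (LINT s:{a..b}|lborel. k s)"
proof -
  have "norm (LINT s:{a..b}|lborel. g s) \<le> (LINT s:{a..b}|lborel. norm (g s))"
    by (rule set_integral_norm_bound) fact
  also have "\<dots> \<le> (LINT s:{a..b}|lborel. k s)"
    using assms by (intro set_integral_mono set_integrable_norm) auto
  finally show ?thesis .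
qed

lemma set_integrable_continuous_Icc:
  fixes g :: "real \<Rightarrow> 'e::euclidean_space"
  assumes "continuous_on {a..b} g"
  shows "set_integrable lborel {a..b} g"
  using borel_integrable_compact[OF _ assms] by (simp add: set_integrable_def)

lemma set_integral_const_Icc:
  fixes c :: real
  assumes "a \<le> b"
  shows "(LINT s:{a..b}|lborel. c) = (b - a) * c"
  using assms by (simp add: set_lebesgue_integral_def)

text \<open>The weight \<open>exp (2 * K * t)\<close> makes the Volterra operator a contraction with factor 1/2.\<close>

lemma Volterra_halves_weight:
  fixes g :: "real \<Rightarrow> 'e::euclidean_space"
  assumes "0 < K" "0 \<le> c" "0 \<le> t" "set_integrable lborel {0..t} g"
    and g: "\<And>s. 0 \<le> s \<Longrightarrow> s \<le> t \<Longrightarrow> norm (g s) \<le> K * (c * exp (2 * K * s))"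
  shows "norm (LINT s:{0..t}|lborel. g s) \<le> c / 2 * exp (2 * K * t)"
proof -
  have int: "set_integrable lborel {0..t} (\<lambda>s. K * (c * exp (2 * K * s)))"
    by (intro set_integrable_continuous_Icc continuous_intros)
  \<comment> \<open>Integrating the weight divides by \<open>2 * K\<close> while the Lipschitz
    factor is only \<open>K\<close>: this is the origin of 1/2. The lower end point contributes
    \<open>- c / 2\<close>, which is dropped at the end.\<close>
  have "((\<lambda>s. K * (c * exp (2 * K * s))) has_integral
           (c / 2 * exp (2 * K * t) - c / 2 * exp (2 * K * 0))) {0..t}"
    by (rule fundamental_theorem_of_calculus[OF assms(3)])
       (auto simp flip: has_real_derivative_iff_has_vector_derivative intro!: derivative_eq_intros)
  from integral_unique[OF this]
  have "(LINT s:{0..t}|lborel. K * (c * exp (2 * K * s))) = c / 2 * exp (2 * K * t) - c / 2"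
    unfolding set_borel_integral_eq_integral(2)[OF int] by (simp only: mult_zero_right exp_zero mult_1_right)
  moreover have "norm (LINT s:{0..t}|lborel. g s) \<le> (LINT s:{0..t}|lborel. K * (c * exp (2 * K * s)))"
    by (rule norm_set_lborel_integral_le) (use assms int in auto)
  ultimately show ?thesis using assms(2) by simp
qed

primrec picard :: "(real \<Rightarrow> 'e \<Rightarrow> 'e::euclidean_space) \<Rightarrow> 'e \<Rightarrow> nat \<Rightarrow> real \<Rightarrow> 'e" where
  "picard f x 0 t = x"
| "picard f x (Suc n) t = x + (LINT s:{0..t}|lborel. f s (picard f x n s))"

text \<open>A pointwise \<open>lim\<close> makes the solution one function on the whole half-line:
  uniform convergence on each \<open>{0..T}\<close> is proved about this same function, so no gluing
  of local solutions is needed.\<close>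

definition picard_limit :: "(real \<Rightarrow> 'e \<Rightarrow> 'e::euclidean_space) \<Rightarrow> 'e \<Rightarrow> real \<Rightarrow> 'e" where
  "picard_limit f x t = lim (\<lambda>n. picard f x n t)"

text \<open>The field of a single path. Measurability is required in composed form, for
  \<open>f s (u s)\<close>, because this is what integration uses and what a field switched by a
  measurable path satisfies directly. The integrability of \<open>f s 0\<close> and the Lipschitz
  bound together give linear growth.\<close>

locale caratheodory_field =
  fixes f :: "real \<Rightarrow> 'e::euclidean_space \<Rightarrow> 'e" and K :: real
  assumes K_pos: "0 < K"
    and lipschitz: "\<And>s u v. 0 \<le> s \<Longrightarrow> norm (f s u - f s v) \<le> K * norm (u - v)"
    and measurable: "\<And>u T. set_borel_measurable lborel {0..T} u \<Longrightarrow>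
                       set_borel_measurable lborel {0..T} (\<lambda>s. f s (u s))"
    and integrable_zero: "\<And>T. set_integrable lborel {0..T} (\<lambda>s. f s 0)"
begin

lemma integrable_along:
  assumes "continuous_on {0..T} u"
  shows "set_integrable lborel {0..T} (\<lambda>s. f s (u s))"
proof -
  have int: "set_integrable lborel {0..T} (\<lambda>s. norm (f s 0) + K * norm (u s))"
    by (intro set_integral_add set_integrable_norm integrable_zero set_integrable_continuous_Icc
        continuous_intros assms)
  have meas: "set_borel_measurable lborel {0..T} (\<lambda>s. f s (u s))"
    using set_integrable_continuous_Icc[OF assms]
    by (intro measurable) (auto simp: set_integrable_def set_borel_measurable_def)
  have "norm (f s (u s)) \<le> norm (f s 0) + K * norm (u s)" if "s \<in> {0..T}" for s
    using lipschitz[of s "u s" 0] norm_triangle_ineq[of "f s 0" "f s (u s) - f s 0"] that by auto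
  then show ?thesis
    using int meas K_pos unfolding set_integrable_def set_borel_measurable_def
    by (elim Bochner_Integration.integrable_bound) (auto intro!: AE_I2 simp: indicator_def)
qed

lemma continuous_on_picard: "continuous_on {0..T} (picard f x n)"
proof (induction n)
  case (Suc n)
  show ?case
    using continuous_on_set_lborel_integral[OF integrable_along[OF Suc]]
    by (auto intro!: continuous_intros simp: fun_eq_iff)
qed (simp add: fun_eq_iff)

text \<open>The contraction estimate for the weighted sup norm, kept general in \<open>u\<close> and
  \<open>v\<close> because it serves three times: for the increments of the iterates, for passing to
  the limit under the integral, and for uniqueness.\<close>

lemma difference_integral_bound:
  assumes "continuous_on {0..T} u" "continuous_on {0..T} v" "0 \<le> t" "t \<le> T" "0 \<le> c"
    and d: "\<And>s. 0 \<le> s \<Longrightarrow> s \<le> t \<Longrightarrow> norm (u s - v s) \<le> c * exp (2 * K * s)"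
  shows "norm ((LINT s:{0..t}|lborel. f s (u s)) - (LINT s:{0..t}|lborel. f s (v s)))
          \<le> c / 2 * exp (2 * K * t)"
proof -
  have "set_integrable lborel {0..t} (\<lambda>s. f s (u s))" "set_integrable lborel {0..t} (\<lambda>s. f s (v s))"
    using assms by (auto intro!: integrable_along elim: continuous_on_subset)
  moreover have "norm (f s (u s) - f s (v s)) \<le> K * (c * exp (2 * K * s))"
    if "0 \<le> s" "s \<le> t" for s
    using lipschitz[of s "u s" "v s"] d[of s] K_pos that
    by (meson mult_left_mono order_trans less_imp_le)
  ultimately show ?thesis
    using Volterra_halves_weight[of K c t "\<lambda>s. f s (u s) - f s (v s)"] assms K_pos by simp
qed

lemma picard_increment:
  obtains C where "0 \<le> C"
    "\<And>n t. 0 \<le> t \<Longrightarrow> t \<le> T \<Longrightarrow>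
       norm (picard f x (Suc n) t - picard f x n t) \<le> C * (1/2)^n * exp (2 * K * t)"
proof -
  \<comment> \<open>The first increment is continuous, hence bounded on \<open>{0..T}\<close>; its
    bound is the constant \<open>C\<close>, and every further iteration halves it in the weighted
    norm.\<close>
  have "continuous_on {0..T} (\<lambda>t. picard f x (Suc 0) t - picard f x 0 t)"
    by (intro continuous_intros continuous_on_picard)
  then have "bounded ((\<lambda>t. picard f x (Suc 0) t - picard f x 0 t) ` {0..T})"
    by (intro compact_imp_bounded compact_continuous_image) auto
  then obtain C where C: "0 < C" "\<And>t. t \<in> {0..T} \<Longrightarrow> norm (picard f x (Suc 0) t - picard f x 0 t) \<le> C"
    unfolding bounded_pos by blast
  have "norm (picard f x (Suc n) t - picard f x n t) \<le> C * (1/2)^n * exp (2 * K * t)"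
    if "0 \<le> t" "t \<le> T" for n t
    using that
  proof (induction n arbitrary: t)
    case 0
    have "C * 1 \<le> C * exp (2 * K * t)" using 0 K_pos C by (intro mult_left_mono) auto
    then show ?case using C(2)[of t] 0 by simp
  next
    case (Suc n)
    have "norm ((LINT s:{0..t}|lborel. f s (picard f x (Suc n) s)) - (LINT s:{0..t}|lborel. f s (picard f x n s)))
          \<le> (C * (1/2)^n) / 2 * exp (2 * K * t)"
      using Suc C by (intro difference_integral_bound[where T=T] continuous_on_picard) auto
    then show ?case by (simp only: picard.simps) simp
  qed
  then show ?thesis using C that by (meson less_imp_le)
qed

text \<open>The iterates are \<open>x\<close> plus the partial sums of their increments, and these
  are dominated by a geometric series, so the Weierstrass M-test applies.\<close>

lemma uniform_limit_picard:
  "uniform_limit {0..T} (picard f x) (picard_limit f x) sequentially"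
proof -
  obtain C where C: "0 \<le> C" "\<And>n t. 0 \<le> t \<Longrightarrow> t \<le> T \<Longrightarrow>
       norm (picard f x (Suc n) t - picard f x n t) \<le> C * (1/2)^n * exp (2 * K * t)"
    by (rule picard_increment[of T x]) (rule that)
  let ?d = "\<lambda>n t. picard f x (Suc n) t - picard f x n t"
  have "norm (?d n t) \<le> C * exp (2 * K * T) * (1/2)^n" if "t \<in> {0..T}" for n t
  proof -
    have "norm (?d n t) \<le> C * (1/2)^n * exp (2 * K * t)" using C(2) that by simp
    also have "\<dots> \<le> C * (1/2)^n * exp (2 * K * T)"
      using that C K_pos by (intro mult_left_mono) auto
    finally show ?thesis by (simp add: ac_simps)
  qed
  then have "uniform_limit {0..T} (\<lambda>n t. \<Sum>i<n. ?d i t) (\<lambda>t. suminf (\<lambda>i. ?d i t)) sequentially"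
    by (intro Weierstrass_m_test[where M="\<lambda>n. C * exp (2 * K * T) * (1/2)^n"])
       (auto intro!: summable_mult summable_geometric)
  moreover have "(\<lambda>n t. \<Sum>i<n. ?d i t) = (\<lambda>n t. picard f x n t - x)"
    by (intro ext, subst sum_lessThan_telescope[where f="\<lambda>i. picard f x i t" for t]) (simp only: picard.simps(1))
  ultimately have "uniform_limit {0..T} (\<lambda>n t. picard f x n t - x) (\<lambda>t. suminf (\<lambda>i. ?d i t)) sequentially"
    by simp
  from uniform_limit_add[OF this uniform_limit_const[where c="\<lambda>_. x"]]
  have lim: "uniform_limit {0..T} (picard f x) (\<lambda>t. suminf (\<lambda>i. ?d i t) + x) sequentially"
    by simp
  have "picard_limit f x t = suminf (\<lambda>i. ?d i t) + x" if "t \<in> {0..T}" for t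
    unfolding picard_limit_def using tendsto_uniform_limitI[OF lim that] by (rule limI)
  then have "uniform_limit {0..T} (picard f x) (picard_limit f x) sequentially \<longleftrightarrow>
      uniform_limit {0..T} (picard f x) (\<lambda>t. suminf (\<lambda>i. ?d i t) + x) sequentially"
    by (intro uniform_limit_cong') auto
  then show ?thesis using lim by blast
qed

lemma continuous_on_picard_limit: "continuous_on {0..T} (picard_limit f x)"
  using uniform_limit_picard by (rule uniform_limit_theorem[rotated]) (auto simp: continuous_on_picard)

lemma picard_tendsto: "0 \<le> t \<Longrightarrow> (\<lambda>n. picard f x n t) \<longlonglongrightarrow> picard_limit f x t"
  using tendsto_uniform_limitI[OF uniform_limit_picard[where T=t], of t] by simp

lemma picard_limit_solves:
  assumes "0 \<le> t"
  shows "picard_limit f x t = x + (LINT s:{0..t}|lborel. f s (picard_limit f x s))"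
proof -
  let ?y = "picard_limit f x"
  have "(\<lambda>n. LINT s:{0..t}|lborel. f s (picard f x n s)) \<longlonglongrightarrow> (LINT s:{0..t}|lborel. f s (?y s))"
  proof (rule LIMSEQ_I)
    fix e :: real assume "0 < e"
    \<comment> \<open>Uniform closeness \<open>?c\<close> implies the weighted closeness because the
      weight is at least 1. The contraction then returns at most
      \<open>?c / 2 * exp (2 * K * t)\<close>, which is \<open>e / 2\<close>.\<close>
    let ?c = "e / exp (2 * K * t)"
    have "0 < ?c" using \<open>0 < e\<close> by simp
    then obtain N where N: "\<And>n s. N \<le> n \<Longrightarrow> s \<in> {0..t} \<Longrightarrow> dist (picard f x n s) (?y s) < ?c"
      using uniform_limit_picard[where T=t and x=x] 
      unfolding uniform_limit_iff eventually_sequentially by metis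
    have "norm ((LINT s:{0..t}|lborel. f s (picard f x n s)) - (LINT s:{0..t}|lborel. f s (?y s))) < e"
      if n: "N \<le> n" for n
    proof -
      have "norm (picard f x n s - ?y s) \<le> ?c * exp (2 * K * s)" if "0 \<le> s" "s \<le> t" for s
      proof -
        have "?c * 1 \<le> ?c * exp (2 * K * s)"
          using that K_pos \<open>0 < ?c\<close> by (intro mult_left_mono) auto
        then show ?thesis using N[OF n, of s] that by (simp add: dist_norm)
      qed
      then have "norm ((LINT s:{0..t}|lborel. f s (picard f x n s)) - (LINT s:{0..t}|lborel. f s (?y s)))
          \<le> ?c / 2 * exp (2 * K * t)"
        using assms \<open>0 < ?c\<close>
        by (intro difference_integral_bound[where T=t] continuous_on_picard continuous_on_picard_limit)
           auto
      then show ?thesis using \<open>0 < e\<close> by simp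
    qed
    then show "\<exists>N. \<forall>n\<ge>N. norm ((LINT s:{0..t}|lborel. f s (picard f x n s)) -
        (LINT s:{0..t}|lborel. f s (?y s))) < e" by blast
  qed
  then have "(\<lambda>n. picard f x (Suc n) t) \<longlonglongrightarrow> x + (LINT s:{0..t}|lborel. f s (?y s))"
    by (auto intro: tendsto_intros)
  moreover have "(\<lambda>n. picard f x (Suc n) t) \<longlonglongrightarrow> ?y t"
    using picard_tendsto[OF assms] by (rule LIMSEQ_Suc)
  ultimately show ?thesis by (rule LIMSEQ_unique[rotated])
qed

text \<open>No Gronwall lemma is used: at a maximum point of the weighted distance between the two
  solutions, the contraction bounds the maximum by half of itself.\<close>

lemma solution_unique:
  assumes int: "\<And>t. 0 \<le> t \<Longrightarrow> set_integrable lborel {0..t} (\<lambda>s. f s (y s))"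
    and sol: "\<And>t. 0 \<le> t \<Longrightarrow> y t = x + (LINT s:{0..t}|lborel. f s (y s))"
    and "0 \<le> t"
  shows "y t = picard_limit f x t"
proof -
  let ?z = "picard_limit f x"
  have "continuous_on {0..t} (\<lambda>t. x + (LINT s:{0..t}|lborel. f s (y s)))"
    using assms by (intro continuous_intros continuous_on_set_lborel_integral)
  then have cy: "continuous_on {0..t} y"
    by (rule continuous_on_eq) (simp add: sol[symmetric])
  let ?w = "\<lambda>s. norm (y s - ?z s) / exp (2 * K * s)"
  have "continuous_on {0..t} ?w"
    by (intro continuous_intros cy continuous_on_picard_limit) auto
  then obtain m where m: "m \<in> {0..t}" "\<And>s. s \<in> {0..t} \<Longrightarrow> ?w s \<le> ?w m"
    using continuous_attains_sup[of "{0..t}" ?w] \<open>0 \<le> t\<close> by auto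
  have "norm (y m - ?z m) = norm ((LINT s:{0..m}|lborel. f s (y s)) - (LINT s:{0..m}|lborel. f s (?z s)))"
    using sol[of m] picard_limit_solves[where t=m and x=x] m(1) by (metis add_diff_cancel_left atLeastAtMost_iff)
  also have "\<dots> \<le> ?w m / 2 * exp (2 * K * m)"
    using m
    by (intro difference_integral_bound[where T=t] cy continuous_on_picard_limit)
       (auto simp: pos_divide_le_eq)
  finally have "?w m \<le> ?w m / 2" by (simp add: field_simps)
  then have "?w m \<le> 0" by simp
  then have "?w t \<le> 0" using m(2)[of t] \<open>0 \<le> t\<close> by auto
  then show ?thesis by (simp add: divide_le_0_iff)
qed

end

section \<open>Pathwise estimates over one time step\<close>

text \<open>Cauchy-Schwarz against the constant 1, obtained by integrating the squared deviation of
  \<open>g\<close> from its mean \<open>c\<close> over the step.\<close>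

lemma square_set_integral_le:
  fixes g :: "real \<Rightarrow> real"
  assumes "0 < h" "set_integrable lborel {t..t+h} g" "set_integrable lborel {t..t+h} (\<lambda>s. (g s)\<^sup>2)"
  shows "(LINT s:{t..t+h}|lborel. g s)\<^sup>2 \<le> h * (LINT s:{t..t+h}|lborel. (g s)\<^sup>2)"
proof -
  let ?I = "LINT s:{t..t+h}|lborel. g s" and ?J = "LINT s:{t..t+h}|lborel. (g s)\<^sup>2"
  define c where "c = ?I / h"
  have const: "set_integrable lborel {t..t+h} (\<lambda>_. c\<^sup>2)"
    by (intro set_integrable_continuous_Icc continuous_intros)
  have "0 \<le> (LINT s:{t..t+h}|lborel. (g s - c)\<^sup>2)"
    unfolding set_lebesgue_integral_def by (intro integral_nonneg_AE) auto
  also have "\<dots> = (LINT s:{t..t+h}|lborel. (g s)\<^sup>2 - (2 * c) * g s + c\<^sup>2)"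
    by (simp add: power2_eq_square algebra_simps)
  also have "\<dots> = ?J - 2 * c * ?I + h * c\<^sup>2"
    using assms const set_integral_const_Icc[of t "t + h" "c\<^sup>2"] by simp
  also have "\<dots> = ?J - ?I\<^sup>2 / h"
    using assms(1) by (simp add: c_def field_simps power2_eq_square)
  finally show ?thesis using assms(1) by (simp add: field_simps)
qed

lemma set_integrable_norm_of_square:
  fixes b :: "real \<Rightarrow> 'e::euclidean_space"
  assumes "set_borel_measurable lborel {s..t} b" "set_integrable lborel {s..t} (\<lambda>r. (norm (b r))\<^sup>2)"
  shows "set_integrable lborel {s..t} b"
proof -
  have int: "set_integrable lborel {s..t} (\<lambda>r. 1 + (norm (b r))\<^sup>2)"
    by (intro set_integral_add assms set_integrable_continuous_Icc continuous_intros)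
  have "norm (b r) \<le> 1 + (norm (b r))\<^sup>2" for r
  proof -
    have "0 \<le> (norm (b r) - 1)\<^sup>2 + 1 + (norm (b r))\<^sup>2" by simp
    then show ?thesis by (simp add: power2_diff)
  qed
  then show ?thesis
    using int assms(1) unfolding set_integrable_def set_borel_measurable_def
    by (elim Bochner_Integration.integrable_bound) (auto intro!: AE_I2 simp: indicator_def)
qed

lemma set_integral_of_bool_Icc:
  assumes "0 \<le> h" "set_borel_measurable lborel {t..t+h} (\<lambda>s. of_bool (R s) :: real)"
  shows "set_integrable lborel {t..t+h} (\<lambda>s. of_bool (R s) :: real)"
    and "0 \<le> (LINT s:{t..t+h}|lborel. of_bool (R s) :: real)"
    and "(LINT s:{t..t+h}|lborel. of_bool (R s) :: real) \<le> h"
proof -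
  have one: "set_integrable lborel {t..t+h} (\<lambda>s. 1::real)"
    by (intro set_integrable_continuous_Icc continuous_intros)
  then show int: "set_integrable lborel {t..t+h} (\<lambda>s. of_bool (R s) :: real)"
    using assms(2) unfolding set_integrable_def set_borel_measurable_def
    by (elim Bochner_Integration.integrable_bound) (auto intro!: AE_I2 simp: indicator_def)
  show "0 \<le> (LINT s:{t..t+h}|lborel. of_bool (R s) :: real)"
    unfolding set_lebesgue_integral_def by (intro integral_nonneg_AE) auto
  have "(LINT s:{t..t+h}|lborel. of_bool (R s) :: real) \<le> (LINT s:{t..t+h}|lborel. 1)"
    using int one by (intro set_integral_mono) auto
  then show "(LINT s:{t..t+h}|lborel. of_bool (R s) :: real) \<le> h"
    using set_integral_const_Icc[of t "t+h" 1] assms(1) by simp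
qed

text \<open>One deterministic path over one step \<open>[t, t + h]\<close>. The smallness condition
  \<open>2 * K * h \<le> 1\<close> lets the contribution of the linear part be absorbed on the
  left-hand side. The equation for \<open>X\<close> is restarted at \<open>t\<close>.\<close>

context
  fixes a :: "real \<Rightarrow> 's::finite" and A :: "'s \<Rightarrow> real^'n^'n" and b X :: "real \<Rightarrow> real^'n"
    and K t h :: real
  assumes K: "0 < K" "\<And>i v. norm (A i *v v) \<le> K * norm v"
    and h: "0 < h" "2 * K * h \<le> 1"
    and b_meas: "set_borel_measurable lborel {t..t+h} b"
    and b_sq: "set_integrable lborel {t..t+h} (\<lambda>s. (norm (b s))\<^sup>2)"
    and a_meas: "set_borel_measurable lborel {t..t+h} (\<lambda>s. of_bool (a s \<noteq> a t) :: real)"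
    and f_int: "set_integrable lborel {t..t+h} (\<lambda>s. A (a s) *v X s + b s)"
    and X: "\<And>s. t \<le> s \<Longrightarrow> s \<le> t + h \<Longrightarrow> X s = X t + (LINT r:{t..s}|lborel. A (a r) *v X r + b r)"
begin

private abbreviation (input) "B \<equiv> LINT s:{t..t+h}|lborel. norm (b s)"
text \<open>\<open>J\<close> is the time spent in a state other than the one held at
  \<open>t\<close>. Together with the final state it is the only channel through which jumps enter
  the step estimates.\<close>

private abbreviation (input) "\<beta> \<equiv> LINT s:{t..t+h}|lborel. (norm (b s))\<^sup>2"
private abbreviation (input) "J \<equiv> LINT s:{t..t+h}|lborel. of_bool (a s \<noteq> a t) :: real"

lemma step_b_integrable: "set_integrable lborel {t..t+h} (\<lambda>s. norm (b s))"
  using set_integrable_norm_of_square[OF b_meas b_sq] by (rule set_integrable_norm)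

lemma step_B_nonneg: "0 \<le> B"
  unfolding set_lebesgue_integral_def by (intro integral_nonneg_AE) auto

lemma step_B_square: "B\<^sup>2 \<le> h * \<beta>"
  by (rule square_set_integral_le) (use h step_b_integrable b_sq in auto)

lemma step_continuous: "continuous_on {t..t+h} X"
proof -
  have "continuous_on {t..t+h} (\<lambda>s. X t + (LINT r:{t..s}|lborel. A (a r) *v X r + b r))"
    by (intro continuous_intros continuous_on_set_lborel_integral f_int)
  then show ?thesis by (rule continuous_on_eq) (simp add: X[symmetric])
qed

lemma step_integral_le:
  fixes g :: "real \<Rightarrow> real^'n"
  assumes "t \<le> s" "s \<le> t + h" "set_integrable lborel {t..t+h} g"
    and "\<And>r. t \<le> r \<Longrightarrow> r \<le> t + h \<Longrightarrow> norm (g r) \<le> c + norm (b r)" "0 \<le> c"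
  shows "norm (LINT r:{t..s}|lborel. g r) \<le> c * h + B"
proof -
  have sub: "set_integrable lborel {t..s} g" "set_integrable lborel {t..s} (\<lambda>r. norm (b r))"
    using assms step_b_integrable by (auto elim: set_integrable_subset)
  have c: "set_integrable lborel {t..s} (\<lambda>_. c)" 
    by (intro set_integrable_continuous_Icc continuous_intros)
  have "norm (LINT r:{t..s}|lborel. g r) \<le> (LINT r:{t..s}|lborel. c + norm (b r))"
    using assms sub c by (intro norm_set_lborel_integral_le set_integral_add) auto
  also have "\<dots> = (s - t) * c + (LINT r:{t..s}|lborel. norm (b r))"
    using sub c assms by (simp add: set_integral_const_Icc)
  also have "(LINT r:{t..s}|lborel. norm (b r)) \<le> B"
    unfolding set_lebesgue_integral_def
    using sub step_b_integrable assms unfolding set_integrable_def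
    by (intro integral_mono) (auto simp: indicator_def)
  also have "(s - t) * c \<le> h * c" using assms by (intro mult_right_mono) auto
  finally show ?thesis by (simp add: ac_simps)
qed

text \<open>At a maximum point \<open>m\<close> of the norm, the linear part contributes at most
  \<open>K * h * norm (X m)\<close>, which is at most half of \<open>norm (X m)\<close> and can be
  absorbed; this gives the factor 2.\<close>

lemma step_sup_bound:
  assumes "t \<le> s" "s \<le> t + h"
  shows "norm (X s) \<le> 2 * (norm (X t) + B)"
proof -
  obtain m where m: "m \<in> {t..t+h}" "\<And>s. s \<in> {t..t+h} \<Longrightarrow> norm (X s) \<le> norm (X m)"
    using continuous_attains_sup[OF _ _ continuous_on_norm[OF step_continuous]] h
    by (metis atLeastAtMost_iff compact_Icc empty_iff less_add_same_cancel1 less_imp_le order_refl)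
  have "norm (A (a r) *v X r + b r) \<le> K * norm (X m) + norm (b r)" if "t \<le> r" "r \<le> t + h" for r
  proof -
    have "K * norm (X r) \<le> K * norm (X m)" using m(2)[of r] that K(1) by (intro mult_left_mono) auto
    then show ?thesis
      using norm_triangle_ineq[of "A (a r) *v X r" "b r"] K(2)[of "a r" "X r"] by linarith
  qed
  then have "norm (LINT r:{t..m}|lborel. A (a r) *v X r + b r) \<le> (K * norm (X m)) * h + B"
    using m(1) K(1) by (intro step_integral_le f_int) auto
  moreover have "norm (X m) \<le> norm (X t) + norm (LINT r:{t..m}|lborel. A (a r) *v X r + b r)"
  proof -
    have "X m = X t + (LINT r:{t..m}|lborel. A (a r) *v X r + b r)" using m(1) by (intro X) auto
    then show ?thesis by (metis norm_triangle_ineq)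
  qed
  moreover have "(K * norm (X m)) * h \<le> norm (X m) / 2"
    using mult_right_mono[OF h(2), of "norm (X m)"] by (simp add: ac_simps)
  ultimately have "norm (X m) \<le> 2 * (norm (X t) + B)" by simp
  then show ?thesis using m(2)[of s] assms by auto
qed

lemma step_square_bound:
  assumes "t \<le> s" "s \<le> t + h"
  shows "(norm (X s))\<^sup>2 \<le> 8 * ((norm (X t))\<^sup>2 + h * \<beta>)"
proof -
  have "(norm (X s))\<^sup>2 \<le> (2 * (norm (X t) + B))\<^sup>2"
    using step_sup_bound[OF assms] by (intro power_mono) auto
  also have "\<dots> \<le> 8 * ((norm (X t))\<^sup>2 + B\<^sup>2)"
    using sum_squares_bound[of "norm (X t)" B] by (simp add: power2_eq_square algebra_simps)
  finally show ?thesis using step_B_square by simp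
qed

lemma step_increment:
  assumes "t \<le> s" "s \<le> t + h"
  shows "norm (X s - X t) \<le> 2 * K * h * norm (X t) + 2 * B"
proof -
  let ?m = "2 * (norm (X t) + B)"
  have m: "0 \<le> ?m" using step_B_nonneg by simp
  have "norm (A (a r) *v X r + b r) \<le> K * ?m + norm (b r)" if "t \<le> r" "r \<le> t + h" for r
    using norm_triangle_ineq[of "A (a r) *v X r" "b r"] K(2)[of "a r" "X r"] K(1)
      mult_left_mono[OF step_sup_bound[OF that], of K] by linarith
  then have "norm (LINT r:{t..s}|lborel. A (a r) *v X r + b r) \<le> (K * ?m) * h + B"
    using assms K(1) m by (intro step_integral_le f_int) auto
  moreover have "X s - X t = (LINT r:{t..s}|lborel. A (a r) *v X r + b r)"
    using X[OF assms] by simp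
  \<comment> \<open>The supremum bound carries its own copy of \<open>B\<close>; after
    multiplication by \<open>2 * K * h\<close> it is at most one more \<open>B\<close>, whence
    \<open>2 * B\<close> in the conclusion.\<close>
  moreover have "2 * K * h * B \<le> B" using mult_right_mono[OF h(2) step_B_nonneg] by simp
  ultimately show ?thesis by (simp add: algebra_simps)
qed

lemmas step_J_integrable = set_integral_of_bool_Icc(1)[OF less_imp_le[OF h(1)] a_meas]
lemmas step_J_bounds = set_integral_of_bool_Icc(2,3)[OF less_imp_le[OF h(1)] a_meas]

text \<open>An Euler expansion with \<open>A\<close> frozen in the state at \<open>t\<close>. The
  three error terms come from the motion of \<open>X\<close> during the step, from the time
  \<open>J\<close> during which a different matrix acts, and from the noise.\<close>

lemma step_remainder:
  "norm (X (t + h) - X t - h *\<^sub>R (A (a t) *v X t))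
     \<le> 2 * K\<^sup>2 * h\<^sup>2 * norm (X t) + 2 * K * norm (X t) * J + 2 * B"
proof -
  let ?\<xi> = "X t" and ?f = "\<lambda>s. A (a s) *v X s + b s"
  let ?d = "2 * K * h * norm ?\<xi> + 2 * B"
  have const: "set_integrable lborel {t..t+h} (\<lambda>_. A (a t) *v ?\<xi>)"
    "set_integrable lborel {t..t+h} (\<lambda>_. K * ?d)"
    by (intro set_integrable_continuous_Icc continuous_intros)+
  have J_int: "set_integrable lborel {t..t+h} (\<lambda>s. 2 * K * norm ?\<xi> * of_bool (a s \<noteq> a t))"
    using step_J_integrable by (intro set_integrable_mult_right)
  have "set_integrable lborel {t..t+h} (\<lambda>s. ?f s - A (a t) *v ?\<xi>)"
    using f_int const by auto
  moreover have int: "set_integrable lborel {t..t+h}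
      (\<lambda>s. K * ?d + 2 * K * norm ?\<xi> * of_bool (a s \<noteq> a t) + norm (b s))"
    by (intro set_integral_add const J_int step_b_integrable)
  moreover have "norm (?f s - A (a t) *v ?\<xi>)
      \<le> K * ?d + 2 * K * norm ?\<xi> * of_bool (a s \<noteq> a t) + norm (b s)" if "t \<le> s" "s \<le> t + h" for s
  proof -
    have "?f s - A (a t) *v ?\<xi> = A (a s) *v (X s - ?\<xi>) + (A (a s) *v ?\<xi> - A (a t) *v ?\<xi>) + b s"
      by (simp add: matrix_vector_mult_diff_distrib)
    then have "norm (?f s - A (a t) *v ?\<xi>)
        \<le> norm (A (a s) *v (X s - ?\<xi>)) + norm (A (a s) *v ?\<xi> - A (a t) *v ?\<xi>) + norm (b s)"
      by (metis norm_triangle_ineq norm_triangle_le add_right_mono)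
    moreover have "norm (A (a s) *v (X s - ?\<xi>)) \<le> K * ?d"
      using K(2)[of "a s" "X s - ?\<xi>"] mult_left_mono[OF step_increment[OF that], of K] K(1) by linarith
    moreover have "norm (A (a s) *v ?\<xi> - A (a t) *v ?\<xi>) \<le> 2 * K * norm ?\<xi> * of_bool (a s \<noteq> a t)"
      using norm_triangle_ineq4[of "A (a s) *v ?\<xi>" "A (a t) *v ?\<xi>"] K(2)[of "a s" ?\<xi>] K(2)[of "a t" ?\<xi>]
      by auto
    ultimately show ?thesis by simp
  qed
  ultimately have "norm (LINT s:{t..t+h}|lborel. ?f s - A (a t) *v ?\<xi>)
      \<le> (LINT s:{t..t+h}|lborel. K * ?d + 2 * K * norm ?\<xi> * of_bool (a s \<noteq> a t) + norm (b s))"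
    by (rule norm_set_lborel_integral_le)
  also have "\<dots> = h * (K * ?d) + 2 * K * norm ?\<xi> * J + B"
  proof -
    have "(LINT s:{t..t+h}|lborel. K * ?d) = h * (K * ?d)"
      using set_integral_const_Icc[of t "t + h" "K * ?d"] h by simp
    moreover have "(LINT s:{t..t+h}|lborel. 2 * K * norm ?\<xi> * of_bool (a s \<noteq> a t)) = 2 * K * norm ?\<xi> * J"
      by (rule set_integral_mult_right)
    ultimately show ?thesis
      by (simp only: set_integral_add(2)[OF set_integral_add(1)[OF const(2) J_int] step_b_integrable]
          set_integral_add(2)[OF const(2) J_int])
  qed
  also have "\<dots> \<le> 2 * K\<^sup>2 * h\<^sup>2 * norm ?\<xi> + 2 * K * norm ?\<xi> * J + 2 * B"
    using mult_right_mono[OF h(2) step_B_nonneg] by (simp add: power2_eq_square algebra_simps)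
  also have "(LINT s:{t..t+h}|lborel. ?f s - A (a t) *v ?\<xi>) = X (t + h) - ?\<xi> - h *\<^sub>R (A (a t) *v ?\<xi>)"
    using X[of "t + h"] h f_int const
    by (simp add: set_lebesgue_integral_def[of _ _ "\<lambda>_. A (a t) *v ?\<xi>"])
  finally show ?thesis .
qed

text \<open>The weight at the end of the step uses an arbitrary state \<open>i\<close>, which is
  later the random state at \<open>t + h\<close>, while the drift term uses \<open>P (a t)\<close>.
  The indicator of \<open>i \<noteq> a t\<close> pays for this mismatch. \<open>\<epsilon>\<close>
  is the free parameter of Young's inequality.\<close>

lemma step_quadratic:
  assumes \<kappa>: "0 < \<kappa>" "\<And>i v. norm (P i *v v) \<le> \<kappa> * norm v" and sym: "\<And>i. transpose (P i) = P i"
    and "0 < \<epsilon>"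
  shows "X (t + h) \<bullet> (P i *v X (t + h)) \<le> X t \<bullet> (P i *v X t)
     + 2 * h * ((P (a t) *v X t) \<bullet> (A (a t) *v X t))
     + (norm (X t))\<^sup>2 * (4 * h * \<kappa> * K * of_bool (i \<noteq> a t) + 4 * \<kappa> * K * J
          + 42 * \<kappa> * K\<^sup>2 * h\<^sup>2 + 4 * \<kappa> * \<epsilon> * h)
     + \<kappa> * (1 / \<epsilon> + 16 * h) * \<beta>"
proof -
  define \<xi> \<eta> where "\<xi> = X t" and "\<eta> = norm \<xi>"
  define Y where "Y = A (a t) *v \<xi>"
  define R where "R = X (t + h) - \<xi> - h *\<^sub>R Y"
  define Z where "Z = h *\<^sub>R Y + R"
  note J = step_J_bounds and B0 = step_B_nonneg and BB = step_B_square
  have \<eta>: "0 \<le> \<eta>" by (simp add: \<eta>_def)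
  have R1: "norm R \<le> 2 * K\<^sup>2 * h\<^sup>2 * \<eta> + 2 * K * \<eta> * J + 2 * B"
    using step_remainder by (simp add: R_def Y_def \<xi>_def \<eta>_def)
  have Y: "norm Y \<le> K * \<eta>" using K(2) by (simp add: Y_def \<eta>_def)
  have Z: "norm Z \<le> h * (K * \<eta>) + norm R"
    using norm_triangle_ineq[of "h *\<^sub>R Y" R] Y h by (simp add: Z_def) (smt (verit) mult_left_mono)
  \<comment> \<open>This cruder bound, of order \<open>h\<close> apart from the noise, uses only
    \<open>J \<le> h\<close>. It is enough where \<open>R\<close> occurs squared, whereas the term
    linear in \<open>R\<close> needs the sharper \<open>R1\<close>.\<close>
  have R2: "norm R \<le> 3 * (h * K * \<eta>) + 2 * B"
  proof -
    have "(2 * K * h) * (K * h * \<eta>) \<le> 1 * (K * h * \<eta>)"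
      using h K \<eta> by (intro mult_right_mono) auto
    then have "2 * K\<^sup>2 * h\<^sup>2 * \<eta> \<le> h * K * \<eta>" by (simp add: power2_eq_square ac_simps)
    moreover have "2 * K * \<eta> * J \<le> 2 * K * \<eta> * h" using J K \<eta> by (intro mult_left_mono) auto
    ultimately show ?thesis using R1 by (simp add: ac_simps)
  qed
  have split: "X (t + h) \<bullet> (P i *v X (t + h)) =
      \<xi> \<bullet> (P i *v \<xi>) + 2 * h * ((P i *v \<xi>) \<bullet> Y) + 2 * ((P i *v \<xi>) \<bullet> R) + Z \<bullet> (P i *v Z)"
  proof -
    have XZ: "X (t + h) = \<xi> + Z" by (simp add: Z_def R_def)
    have "\<xi> \<bullet> (P i *v Z) = (P i *v \<xi>) \<bullet> Z"
      by (metis dot_lmul_matrix sym transpose_matrix_vector)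
    then show ?thesis
      unfolding XZ by (simp add: matrix_vector_right_distrib inner_add inner_commute[of Z "P i *v \<xi>"])
         (simp add: Z_def inner_add algebra_simps)
  qed
  have CS: "\<bar>(P j *v u) \<bullet> v\<bar> \<le> \<kappa> * norm u * norm v" for j u v
  proof -
    have "\<bar>(P j *v u) \<bullet> v\<bar> \<le> norm (P j *v u) * norm v" by (rule Cauchy_Schwarz_ineq2)
    also have "\<dots> \<le> \<kappa> * norm u * norm v" using \<kappa>(2)[of j u] by (intro mult_right_mono) auto
    finally show ?thesis .
  qed
  have t1: "2 * h * ((P i *v \<xi>) \<bullet> Y) \<le> 2 * h * ((P (a t) *v \<xi>) \<bullet> Y) + \<eta>\<^sup>2 * (4 * h * \<kappa> * K * of_bool (i \<noteq> a t))"
  proof (cases "i = a t")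
    case False
    have c: "\<bar>(P j *v \<xi>) \<bullet> Y\<bar> \<le> \<kappa> * K * \<eta>\<^sup>2" for j
    proof -
      have "\<kappa> * norm \<xi> * norm Y \<le> \<kappa> * norm \<xi> * (K * \<eta>)"
        using Y \<kappa>(1) by (intro mult_left_mono) auto
      then show ?thesis using CS[of j \<xi> Y] by (simp add: \<eta>_def power2_eq_square ac_simps)
    qed
    have "2 * h * ((P i *v \<xi>) \<bullet> Y - (P (a t) *v \<xi>) \<bullet> Y) \<le> 2 * h * (2 * (\<kappa> * K * \<eta>\<^sup>2))"
      using c[of i] c[of "a t"] h by (intro mult_left_mono) auto
    then show ?thesis using False by (simp add: algebra_simps)
  qed simp
  have t2: "2 * ((P i *v \<xi>) \<bullet> R) \<le> \<eta>\<^sup>2 * (4 * \<kappa> * K\<^sup>2 * h\<^sup>2 + 4 * \<kappa> * K * J + 4 * \<kappa> * \<epsilon> * h) + \<kappa> / \<epsilon> * \<beta>"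
  proof -
    have "2 * ((P i *v \<xi>) \<bullet> R) \<le> 2 * (\<kappa> * \<eta> * norm R)" using CS[of i \<xi> R] by (simp add: \<eta>_def)
    also have "\<dots> \<le> 2 * (\<kappa> * \<eta> * (2 * K\<^sup>2 * h\<^sup>2 * \<eta> + 2 * K * \<eta> * J + 2 * B))"
      using R1 \<kappa> \<eta> by (intro mult_left_mono) auto
    also have "\<dots> = \<eta>\<^sup>2 * (4 * \<kappa> * K\<^sup>2 * h\<^sup>2 + 4 * \<kappa> * K * J) + 4 * \<kappa> * (\<eta> * B)"
      by (simp add: power2_eq_square algebra_simps)
    finally have 1: "2 * ((P i *v \<xi>) \<bullet> R) \<le>
      \<eta>\<^sup>2 * (4 * \<kappa> * K\<^sup>2 * h\<^sup>2 + 4 * \<kappa> * K * J) + 4 * \<kappa> * (\<eta> * B)" .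
    \<comment> \<open>Young's inequality for \<open>\<eta> * B\<close>, scaled so that the square of
      \<open>B\<close> is replaced by \<open>h * \<beta>\<close>. Dividing by
      \<open>4 * \<epsilon> * h\<close> then cancels this \<open>h\<close>, and the coefficient of
      \<open>\<beta>\<close> does not depend on \<open>h\<close>.\<close>
    have "0 \<le> (2 * \<epsilon> * h * \<eta> - B)\<^sup>2" by simp
    then have "4 * \<epsilon> * h * (\<eta> * B) \<le> 4 * \<epsilon> * h * (\<epsilon> * h * \<eta>\<^sup>2) + h * \<beta>"
      using BB by (simp add: power2_eq_square algebra_simps)
    also have "\<dots> = 4 * \<epsilon> * h * (\<epsilon> * h * \<eta>\<^sup>2 + \<beta> / (4 * \<epsilon>))"
      using \<open>0 < \<epsilon>\<close> by (simp add: field_simps)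
    finally have "\<eta> * B \<le> \<epsilon> * h * \<eta>\<^sup>2 + \<beta> / (4 * \<epsilon>)"
      using \<open>0 < \<epsilon>\<close> h by simp
    then have "4 * \<kappa> * (\<eta> * B) \<le> 4 * \<kappa> * (\<epsilon> * h * \<eta>\<^sup>2 + \<beta> / (4 * \<epsilon>))"
      using \<kappa> by (intro mult_left_mono) auto
    with 1 show ?thesis using \<open>0 < \<epsilon>\<close> by (simp add: algebra_simps)
  qed
  have t3: "Z \<bullet> (P i *v Z) \<le> \<eta>\<^sup>2 * (38 * \<kappa> * K\<^sup>2 * h\<^sup>2) + 16 * \<kappa> * h * \<beta>"
  proof -
    have "Z \<bullet> (P i *v Z) \<le> \<kappa> * (norm Z)\<^sup>2"
      using CS[of i Z Z] by (simp add: inner_commute power2_eq_square)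
    also have "norm Z \<le> 4 * (h * K * \<eta>) + 2 * B" using Z R2 by (simp add: ac_simps)
    then have "\<kappa> * (norm Z)\<^sup>2 \<le> \<kappa> * (4 * (h * K * \<eta>) + 2 * B)\<^sup>2"
      using \<kappa> by (intro mult_left_mono power_mono) auto
    also have "\<dots> \<le> \<kappa> * (32 * (h * K * \<eta>)\<^sup>2 + 8 * B\<^sup>2)"
      using \<kappa> sum_squares_bound[of "4 * (h * K * \<eta>)" "2 * B"]
      by (intro mult_left_mono) (auto simp: power2_sum power_mult_distrib algebra_simps)
    \<comment> \<open>The coefficients 32 and 8 are merely rounded up. With the 4 coming from
      \<open>t2\<close>, the 38 makes the 42 of the statement.\<close>
    also have "\<dots> \<le> \<kappa> * (38 * (h * K * \<eta>)\<^sup>2 + 16 * (h * \<beta>))"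
    proof -
      have "8 * B\<^sup>2 \<le> 16 * (h * \<beta>)" using BB zero_le_power2[of B] by linarith
      then show ?thesis using \<kappa> by (intro mult_left_mono add_mono) auto
    qed
    finally show ?thesis by (simp add: power_mult_distrib algebra_simps)
  qed
  show ?thesis
    using split t1 t2 t3 unfolding \<xi>_def[symmetric] \<eta>_def[symmetric] Y_def[symmetric]
    by (simp add: algebra_simps)
qed

end

section \<open>Progressive measurability\<close>

text \<open>An arbitrary target measure is allowed so that the chain itself, with the discrete
  \<sigma>-algebra on the states, is covered along with vector-valued processes.\<close>

definition prog_measurable_to ::
    "(real \<Rightarrow> 'w measure) \<Rightarrow> 'b measure \<Rightarrow> (real \<Rightarrow> 'w \<Rightarrow> 'b) \<Rightarrow> bool" where
  "prog_measurable_to F N \<phi> \<longleftrightarrow>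
     (\<forall>t\<ge>0. (\<lambda>(s, \<omega>). \<phi> s \<omega>) \<in> measurable (restrict_space borel {0..t} \<Otimes>\<^sub>M F t) N)"

lemma progressively_measurable_iff:
  "progressively_measurable F \<phi> \<longleftrightarrow> prog_measurable_to F borel \<phi>"
  by (simp add: progressively_measurable_def prog_measurable_to_def)

text \<open>Clamping the time argument avoids the restricted time space.\<close>

lemma prog_measurable_clamp:
  assumes "prog_measurable_to F N \<phi>" "0 \<le> t"
  shows "(\<lambda>(s, \<omega>). \<phi> (max 0 (min t s)) \<omega>) \<in> measurable (borel \<Otimes>\<^sub>M F t) N"
proof -
  have "(\<lambda>s::real. max 0 (min t s)) \<in> measurable borel (restrict_space borel {0..t})"
    using assms(2) by (intro measurable_restrict_space2) auto
  then have "(\<lambda>x. (max 0 (min t (fst x)), snd x)) \<in> measurable (borel \<Otimes>\<^sub>M F t) (restrict_space borel {0..t} \<Otimes>\<^sub>M F t)"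
    by (intro measurable_Pair measurable_compose[OF measurable_fst] measurable_snd) 
  moreover have "(\<lambda>(s, \<omega>). \<phi> s \<omega>) \<in> measurable (restrict_space borel {0..t} \<Otimes>\<^sub>M F t) N"
    using assms by (simp add: prog_measurable_to_def)
  ultimately show ?thesis
    by (auto dest!: measurable_compose simp: case_prod_beta)
qed

lemma prog_measurable_adapted:
  assumes "prog_measurable_to F N \<phi>" "0 \<le> t"
  shows "\<phi> t \<in> measurable (F t) N"
proof -
  have "(\<lambda>\<omega>. (t, \<omega>)) \<in> measurable (F t) (borel \<Otimes>\<^sub>M F t)" by measurable
  from measurable_compose[OF this prog_measurable_clamp[OF assms]] show ?thesis
    using assms(2) by simp
qed

text \<open>Each clamped process is jointly measurable up to its own horizon. Choosing the horizon
  as an integer depending on \<open>s\<close> and exceeding it pieces countably many of them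
  together, and there the clamp has no effect. The assumption on the identity map says that
  \<open>F t\<close> is coarser than \<open>M\<close>.\<close>

lemma prog_measurable_joint:
  assumes "prog_measurable_to F N \<phi>" and F: "\<And>t. 0 \<le> t \<Longrightarrow> (\<lambda>\<omega>. \<omega>) \<in> measurable M (F t)"
  shows "(\<lambda>(s, \<omega>). \<phi> (max 0 s) \<omega>) \<in> measurable (borel \<Otimes>\<^sub>M M) N"
proof -
  have "(\<lambda>x. case x of (s, \<omega>) \<Rightarrow> \<phi> (max 0 (min (real (Suc n)) s)) \<omega>) \<in> measurable (borel \<Otimes>\<^sub>M M) N" for n
  proof -
    have "(\<lambda>x. (fst x, snd x)) \<in> measurable (borel \<Otimes>\<^sub>M M) (borel \<Otimes>\<^sub>M F (real (Suc n)))"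
      by (intro measurable_Pair measurable_fst measurable_compose[OF measurable_snd] F) auto
    from measurable_compose[OF this prog_measurable_clamp[OF assms(1), of "real (Suc n)"]] show ?thesis
      by (simp add: case_prod_beta)
  qed
  moreover have "(\<lambda>x. nat \<lfloor>fst x :: real\<rfloor>) \<in> measurable (borel \<Otimes>\<^sub>M M) (count_space UNIV)"
    by (rule measurable_compose[OF measurable_fst]) measurable
  ultimately have "(\<lambda>x. case x of (s, \<omega>) \<Rightarrow> \<phi> (max 0 (min (real (Suc (nat \<lfloor>fst x\<rfloor>))) s)) \<omega>) \<in> measurable (borel \<Otimes>\<^sub>M M) N"
    by (rule measurable_compose_countable)
  moreover have "min (real (Suc (nat \<lfloor>s\<rfloor>))) s = s" for s by linarith
  ultimately show ?thesis by (simp add: case_prod_beta)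
qed

lemma prog_measurable_path:
  assumes "prog_measurable_to F N \<phi>" and F: "\<And>t. 0 \<le> t \<Longrightarrow> (\<lambda>\<omega>. \<omega>) \<in> measurable M (F t)"
    and "\<omega> \<in> space M"
  shows "(\<lambda>s. \<phi> (max 0 s) \<omega>) \<in> measurable borel N"
proof -
  have "(\<lambda>s. (s, \<omega>)) \<in> measurable borel (borel \<Otimes>\<^sub>M M)" using assms(3) by measurable
  from measurable_compose[OF this prog_measurable_joint[OF assms(1,2)]] show ?thesis by simp
qed

text \<open>The upper limit of integration is moved into the integrand as a condition on the
  integration variable, so that measurability of a parameter integral applies. The clamp at
  \<open>t\<close> keeps the integrand \<open>F t\<close>-measurable and changes nothing for upper
  limits up to \<open>t\<close>.\<close>

lemma prog_measurable_integral:
  fixes \<phi> :: "real \<Rightarrow> 'w \<Rightarrow> 'e::euclidean_space"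
  assumes "prog_measurable_to F borel \<phi>"
  shows "prog_measurable_to F borel (\<lambda>t \<omega>. LINT s:{0..t}|lborel. \<phi> s \<omega>)"
  unfolding prog_measurable_to_def
proof safe
  fix t :: real assume t: "0 \<le> t"
  let ?S = "restrict_space borel {0..t} \<Otimes>\<^sub>M F t"
  have fst: "(\<lambda>x. fst (fst x)) \<in> borel_measurable (?S \<Otimes>\<^sub>M lborel)"
    by (intro measurable_compose[OF measurable_fst] measurable_compose[OF measurable_fst[of "restrict_space borel {0..t}"]]
          measurable_restrict_space1 measurable_ident_sets refl)
  have "(\<lambda>x. (snd x, snd (fst x))) \<in> measurable (?S \<Otimes>\<^sub>M lborel) (borel \<Otimes>\<^sub>M F t)"
    by measurable
  from measurable_compose[OF this prog_measurable_clamp[OF assms t]]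
  have \<phi>: "(\<lambda>x. \<phi> (max 0 (min t (snd x))) (snd (fst x))) \<in> borel_measurable (?S \<Otimes>\<^sub>M lborel)"
    by simp
  have set: "{x \<in> space (?S \<Otimes>\<^sub>M lborel). 0 \<le> snd x \<and> snd x \<le> fst (fst x)} \<in> sets (?S \<Otimes>\<^sub>M lborel)"
    using fst by (intro sets.sets_Collect_conj borel_measurable_le) auto
  have "(\<lambda>x. if 0 \<le> snd x \<and> snd x \<le> fst (fst x) then \<phi> (max 0 (min t (snd x))) (snd (fst x)) else 0)
      \<in> borel_measurable (?S \<Otimes>\<^sub>M lborel)"
    by (rule measurable_If[OF \<phi> measurable_const set]) simp
  then have "(\<lambda>y. LINT r|lborel. (if 0 \<le> r \<and> r \<le> fst y then \<phi> (max 0 (min t r)) (snd y) else 0))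
      \<in> borel_measurable ?S"
    by (intro lborel.borel_measurable_lebesgue_integral) (simp add: case_prod_beta)
  moreover have "(LINT r|lborel. (if 0 \<le> r \<and> r \<le> fst y then \<phi> (max 0 (min t r)) (snd y) else 0))
      = (case y of (s, \<omega>) \<Rightarrow> LINT s:{0..s}|lborel. \<phi> s \<omega>)" if "y \<in> space ?S" for y
    using that t unfolding set_lebesgue_integral_def
    by (auto simp: space_pair_measure space_restrict_space indicator_def max_absorb2 min_absorb2
             intro!: Bochner_Integration.integral_cong)
  ultimately show "(\<lambda>(s, \<omega>). LINT s:{0..s}|lborel. \<phi> s \<omega>) \<in> borel_measurable ?S"
    by (simp cong: measurable_cong)
qed

text \<open>Sampling the process at countably many later times, capped at \<open>t\<close>, gives
  jointly measurable approximations. In a discrete state space right-continuity makes them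
  eventually equal to the process, not just convergent.\<close>

lemma prog_measurable_right_continuous:
  fixes \<alpha> :: "real \<Rightarrow> 'w \<Rightarrow> 's::finite"
  assumes adapted: "\<And>s t. 0 \<le> s \<Longrightarrow> s \<le> t \<Longrightarrow> \<alpha> s \<in> measurable (F t) (count_space UNIV)"
    and rc: "\<And>t \<omega>. 0 \<le> t \<Longrightarrow> \<omega> \<in> space (F t) \<Longrightarrow> \<forall>\<^sub>F s in at_right t. \<alpha> s \<omega> = \<alpha> t \<omega>"
    and space: "\<And>s t. 0 \<le> s \<Longrightarrow> 0 \<le> t \<Longrightarrow> space (F s) = space (F t)"
  shows "prog_measurable_to F (count_space UNIV) \<alpha>"
  unfolding prog_measurable_to_def
proof safe
  fix t :: real assume t: "0 \<le> t"
  let ?S = "restrict_space borel {0..t} \<Otimes>\<^sub>M F t"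
  \<comment> \<open>Approximate from the right: \<open>d n \<lfloor>s * Suc n\<rfloor>\<close> tends to \<open>s\<close>, strictly from above unless \<open>s = t\<close>.\<close>
  define d where "d n k = max 0 (min t ((real_of_int k + 1) / real (Suc n)))" for n k
  define \<alpha>n where "\<alpha>n n x = \<alpha> (d n \<lfloor>fst x * real (Suc n)\<rfloor>) (snd x)" for n and x :: "real \<times> 'w"
  have fst: "(\<lambda>x. fst x) \<in> borel_measurable ?S"
    by (intro measurable_compose[OF measurable_fst[of "restrict_space borel {0..t}"]]
          measurable_restrict_space1 measurable_ident_sets refl)
  have \<alpha>n [measurable]: "\<alpha>n n \<in> measurable ?S (count_space UNIV)" for n
    unfolding \<alpha>n_def
  proof (rule measurable_compose_countable[where f="\<lambda>k x. \<alpha> (d n k) (snd x)" and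
        g="\<lambda>x. \<lfloor>fst x * real (Suc n)\<rfloor>"])
    show "(\<lambda>x. \<alpha> (d n k) (snd x)) \<in> measurable ?S (count_space UNIV)" for k
      using t by (intro measurable_compose[OF measurable_snd] adapted) (auto simp: d_def)
    show "(\<lambda>x. \<lfloor>fst x * real (Suc n)\<rfloor>) \<in> measurable ?S (count_space UNIV)"
      using fst by measurable
  qed
  have ev: "\<forall>\<^sub>F n in sequentially. \<alpha>n n (s, \<omega>) = \<alpha> s \<omega>" if s: "0 \<le> s" "s \<le> t" "\<omega> \<in> space (F t)" for s \<omega>
  proof (cases "s = t")
    case True
    have "d n \<lfloor>s * real (Suc n)\<rfloor> = t" for n
    proof -
      have "t \<le> (real_of_int \<lfloor>s * real (Suc n)\<rfloor> + 1) / real (Suc n)"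
        unfolding True by (subst pos_le_divide_eq) (auto intro: less_imp_le)
      then show ?thesis using t by (simp add: d_def)
    qed
    then show ?thesis by (simp add: \<alpha>n_def True)
  next
    case False
    then have "s < t" using s by simp
    obtain c where c: "s < c" "\<And>y. s < y \<Longrightarrow> y < c \<Longrightarrow> \<alpha> y \<omega> = \<alpha> s \<omega>"
      using rc[of s \<omega>] s space[OF s(1) t] unfolding eventually_at_right_field by auto
    have "\<forall>\<^sub>F n in sequentially. 1 / real (Suc n) < c - s"
      using c(1) order_tendstoD(2)[OF LIMSEQ_Suc[OF lim_1_over_n], of "c - s"] by simp
    then show ?thesis
    proof eventually_elim
      case (elim n)
      let ?q = "(real_of_int \<lfloor>s * real (Suc n)\<rfloor> + 1) / real (Suc n)"
      have "s * real (Suc n) < real_of_int \<lfloor>s * real (Suc n)\<rfloor> + 1"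
        "real_of_int \<lfloor>s * real (Suc n)\<rfloor> + 1 \<le> s * real (Suc n) + 1"
        by linarith+
      then have "s < ?q" "?q \<le> (s * real (Suc n) + 1) / real (Suc n)"
        by (auto simp: pos_less_divide_eq simp del: of_nat_Suc intro!: divide_right_mono)
      moreover have "(s * real (Suc n) + 1) / real (Suc n) = s + 1 / real (Suc n)"
        by (simp add: add_divide_distrib del: of_nat_Suc)
      ultimately have "s < d n \<lfloor>s * real (Suc n)\<rfloor>" "d n \<lfloor>s * real (Suc n)\<rfloor> < c"
        using elim \<open>s < t\<close> s unfolding d_def by linarith+
      then show ?case using c(2) by (simp add: \<alpha>n_def)
    qed
  qed
  show "(\<lambda>(s, \<omega>). \<alpha> s \<omega>) \<in> measurable ?S (count_space UNIV)"
  proof (subst measurable_count_space_eq2, simp, intro conjI ballI)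
    fix j :: 's
    \<comment> \<open>Eventual equality turns the event into a lower limit of events about the
      approximations, which is a countable combination.\<close>
    have "(\<lambda>(s, \<omega>). \<alpha> s \<omega>) -` {j} \<inter> space ?S = {x \<in> space ?S. \<exists>N. \<forall>n\<ge>N. \<alpha>n n x = j}"
    proof -
      have "\<alpha> s \<omega> = j \<longleftrightarrow> (\<exists>N. \<forall>n\<ge>N. \<alpha>n n (s, \<omega>) = j)" if "(s, \<omega>) \<in> space ?S" for s \<omega>
      proof -
        have "\<forall>\<^sub>F n in sequentially. \<alpha>n n (s, \<omega>) = \<alpha> s \<omega>"
          using that by (intro ev) (auto simp: space_pair_measure space_restrict_space)
        then obtain N where "\<forall>n\<ge>N. \<alpha>n n (s, \<omega>) = \<alpha> s \<omega>" unfolding eventually_sequentially by blast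
        then show ?thesis by (metis max.cobounded1 max.cobounded2)
      qed
      then have "x \<in> space ?S \<Longrightarrow> (case x of (s, \<omega>) \<Rightarrow> \<alpha> s \<omega>) = j \<longleftrightarrow> (\<exists>N. \<forall>n\<ge>N. \<alpha>n n x = j)" for x
        by (cases x) simp
      then show ?thesis by blast
    qed
    also have "\<dots> \<in> sets ?S" by measurable
    finally show "(\<lambda>(s, \<omega>). \<alpha> s \<omega>) -` {j} \<inter> space ?S \<in> sets ?S" .
  qed simp
qed

section \<open>The augmented natural filtration\<close>

lemma space_augmented_filtration [simp]: "space (augmented_filtration M \<alpha> t) = space M"
  by (simp add: augmented_filtration_def space_measure_of_conv)

lemma sets_augmented_filtration:
  "sets (augmented_filtration M \<alpha> t) =
     sigma_sets (space M) ({\<alpha> s -` B \<inter> space M | s B. 0 \<le> s \<and> s \<le> t} \<union> null_sets M)"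
  unfolding augmented_filtration_def
  by (rule sets_measure_of) (auto dest: null_setsD2 sets.sets_into_space)

lemma null_sets_in_augmented_filtration: "N \<in> null_sets M \<Longrightarrow> N \<in> sets (augmented_filtration M \<alpha> t)"
  unfolding sets_augmented_filtration by (intro sigma_sets.Basic) simp

lemma adapted_augmented_filtration:
  "0 \<le> s \<Longrightarrow> s \<le> t \<Longrightarrow> \<alpha> s \<in> measurable (augmented_filtration M \<alpha> t) (count_space UNIV)"
  by (rule measurableI) (auto simp: sets_augmented_filtration intro!: sigma_sets.Basic)

lemma augmented_filtration_subset:
  assumes "\<And>t. 0 \<le> t \<Longrightarrow> \<alpha> t \<in> measurable M (count_space UNIV)"
  shows "sets (augmented_filtration M \<alpha> t) \<subseteq> sets M"
  unfolding sets_augmented_filtration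
  using assms by (intro sets.sigma_sets_subset) (auto dest: measurable_sets)

section \<open>The randomly switched linear system\<close>

text \<open>For a fixed state the expression is affine in \<open>u\<close> and \<open>c\<close>; the
  state takes only finitely many values, so a case split over them preserves measurability.\<close>

lemma borel_measurable_affine_switch:
  fixes A :: "'s::finite \<Rightarrow> real^'n^'n"
  assumes "a \<in> measurable N (count_space UNIV)" "u \<in> borel_measurable N" "c \<in> borel_measurable N"
  shows "(\<lambda>x. A (a x) *v u x + c x) \<in> borel_measurable N"
proof -
  have "(\<lambda>v. A i *v v) \<in> borel_measurable borel" for i
    by (intro borel_measurable_continuous_onI matrix_vector_mult_linear_continuous_on)
  then have "(\<lambda>x. A i *v u x + c x) \<in> borel_measurable N" for i
    using assms by (intro borel_measurable_add measurable_compose[OF assms(2)]) auto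
  then show ?thesis by (rule measurable_compose_countable[OF _ assms(1)])
qed

lemma set_nn_integral_finite_imp_set_integrable:
  fixes g :: "real \<Rightarrow> real"
  assumes "g \<in> borel_measurable borel" "\<And>s. 0 \<le> g s"
    and "(\<integral>\<^sup>+s\<in>{0..}. ennreal (g s) \<partial>lborel) < \<infinity>"
  shows "set_integrable lborel {0..} g"
  unfolding set_integrable_def
proof (rule integrableI_nonneg)
  have "(\<integral>\<^sup>+s. ennreal (indicator {0..} s *\<^sub>R g s) \<partial>lborel) = (\<integral>\<^sup>+s\<in>{0..}. ennreal (g s) \<partial>lborel)"
    by (intro nn_integral_cong) (auto simp: indicator_def)
  then show "(\<integral>\<^sup>+s. ennreal (indicator {0..} s *\<^sub>R g s) \<partial>lborel) < \<infinity>"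
    using assms(3) by simp
qed (use assms in auto)

text \<open>Progressive measurability of \<alpha> and finite energy in \<open>b_path\<close> are
  demanded for all \<omega>, not just almost all, so that the solution can be defined path by path
  without exceptions. The data are brought into this form by changing them on a null set.\<close>

locale switched_linear_system = prob_space M
  for M :: "'w measure" +
  fixes F :: "real \<Rightarrow> 'w measure" and \<alpha> :: "real \<Rightarrow> 'w \<Rightarrow> 's::finite"
    and A :: "'s \<Rightarrow> real^'n^'n" and b :: "real \<Rightarrow> 'w \<Rightarrow> real^'n" and K :: real
  assumes subalgebra: "\<And>t. 0 \<le> t \<Longrightarrow> subalgebra M (F t)"
    and \<alpha>_prog: "prog_measurable_to F (count_space UNIV) \<alpha>"
    and b_prog: "prog_measurable_to F borel b"
    and b_path: "\<And>\<omega>. \<omega> \<in> space M \<Longrightarrow> (\<integral>\<^sup>+s\<in>{0..}. ennreal ((norm (b s \<omega>))\<^sup>2) \<partial>lborel) < \<infinity>"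
    and b_L2: "(\<integral>\<^sup>+\<omega>. (\<integral>\<^sup>+s\<in>{0..}. ennreal ((norm (b s \<omega>))\<^sup>2) \<partial>lborel) \<partial>M) < \<infinity>"
    and K_pos: "0 < K" and A_bound: "\<And>i v. norm (A i *v v) \<le> K * norm v"
begin

abbreviation drift :: "'w \<Rightarrow> real \<Rightarrow> real^'n \<Rightarrow> real^'n" where
  "drift \<omega> s u \<equiv> A (\<alpha> s \<omega>) *v u + b s \<omega>"

definition X :: "real^'n \<Rightarrow> real \<Rightarrow> 'w \<Rightarrow> real^'n" where
  "X x t \<omega> = picard_limit (drift \<omega>) x t"

lemma ident_measurable: "0 \<le> t \<Longrightarrow> (\<lambda>\<omega>. \<omega>) \<in> measurable M (F t)"
  by (rule measurable_from_subalg[OF subalgebra]) (auto intro: measurable_ident_sets)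

lemma space_F: "0 \<le> t \<Longrightarrow> space (F t) = space M"
  using subalgebra by (simp add: subalgebra_def)

lemmas \<alpha>_path = prog_measurable_path[OF \<alpha>_prog ident_measurable]
lemmas b_path_meas = prog_measurable_path[OF b_prog ident_measurable]

text \<open>Progressive measurability says nothing about negative times; clamping the time at 0
  repairs this and is invisible on an interval with \<open>0 \<le> s\<close>.\<close>

lemma set_measurable_\<alpha>_b:
  assumes "\<omega> \<in> space M" and "set_borel_measurable lborel {s..T} u" and "0 \<le> s"
  shows "set_borel_measurable lborel {s..T} (\<lambda>r. A (\<alpha> r \<omega>) *v u r + b r \<omega>)"
proof -
  have "(\<lambda>r. A (\<alpha> (max 0 r) \<omega>) *v (indicator {s..T} r *\<^sub>R u r) + b (max 0 r) \<omega>) \<in> borel_measurable lborel"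
    using assms(2) \<alpha>_path[OF _ assms(1)] b_path_meas[OF _ assms(1)]
    by (intro borel_measurable_affine_switch) (auto simp: set_borel_measurable_def)
  then have "(\<lambda>r. indicator {s..T} r *\<^sub>R (A (\<alpha> (max 0 r) \<omega>) *v (indicator {s..T} r *\<^sub>R u r) + b (max 0 r) \<omega>)) \<in> borel_measurable lborel"
    by (intro borel_measurable_scaleR) auto
  then show ?thesis
    unfolding set_borel_measurable_def
    by (rule measurable_cong[THEN iffD1, rotated]) (use assms(3) in \<open>auto simp: indicator_def max_def\<close>)
qed

lemma b_set_measurable:
  assumes "\<omega> \<in> space M" "0 \<le> s"
  shows "set_borel_measurable lborel {s..T} (\<lambda>r. b r \<omega>)"
  using set_measurable_\<alpha>_b[OF assms(1) _ assms(2), of T "\<lambda>_. 0"] by (simp add: set_borel_measurable_def)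

lemma b_square_integrable:
  assumes "\<omega> \<in> space M"
  shows "set_integrable lborel {0..} (\<lambda>r. (norm (b r \<omega>))\<^sup>2)"
proof -
  have "(\<integral>\<^sup>+s\<in>{0..}. ennreal ((norm (b (max 0 s) \<omega>))\<^sup>2) \<partial>lborel)
      = (\<integral>\<^sup>+s\<in>{0..}. ennreal ((norm (b s \<omega>))\<^sup>2) \<partial>lborel)"
    by (intro nn_integral_cong) (auto simp: indicator_def max_def)
  then have "set_integrable lborel {0..} (\<lambda>r. (norm (b (max 0 r) \<omega>))\<^sup>2)"
    using b_path[OF assms] b_path_meas[OF _ assms]
    by (intro set_nn_integral_finite_imp_set_integrable) auto
  then show ?thesis
    by (rule set_integrable_cong[THEN iffD1, rotated 3]) auto
qed

lemma b_square_integrable_Icc: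
  assumes "\<omega> \<in> space M" "0 \<le> s"
  shows "set_integrable lborel {s..t} (\<lambda>r. (norm (b r \<omega>))\<^sup>2)"
  by (rule set_integrable_subset[OF b_square_integrable[OF assms(1)]]) (use assms in auto)

lemma b_integrable_Icc:
  assumes "\<omega> \<in> space M" "0 \<le> s"
  shows "set_integrable lborel {s..t} (\<lambda>r. b r \<omega>)"
  using b_set_measurable[OF assms] b_square_integrable_Icc[OF assms] by (rule set_integrable_norm_of_square)

lemma caratheodory_field:
  assumes "\<omega> \<in> space M"
  shows "caratheodory_field (drift \<omega>) K"
proof
  show "norm (drift \<omega> s u - drift \<omega> s v) \<le> K * norm (u - v)" for s u v
    using A_bound[of "\<alpha> s \<omega>" "u - v"] by (simp add: matrix_vector_mult_diff_distrib)
  show "set_borel_measurable lborel {0..T} u \<Longrightarrow> set_borel_measurable lborel {0..T} (\<lambda>s. drift \<omega> s (u s))" for u T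
    using set_measurable_\<alpha>_b[OF assms] by blast
  show "set_integrable lborel {0..T} (\<lambda>s. drift \<omega> s 0)" for T
    using b_integrable_Icc[OF assms] by simp
qed (rule K_pos)

lemma X_integrable:
  assumes "\<omega> \<in> space M" "0 \<le> s"
  shows "set_integrable lborel {s..t} (\<lambda>r. drift \<omega> r (X x r \<omega>))"
proof -
  interpret c: caratheodory_field "drift \<omega>" K by (rule caratheodory_field) fact
  show ?thesis
    unfolding X_def
    by (rule set_integrable_subset[OF c.integrable_along[OF c.continuous_on_picard_limit, where T=t]])
       (use assms in auto)
qed

lemma X_solves:
  assumes "\<omega> \<in> space M" "0 \<le> t"
  shows "X x t \<omega> = x + (LINT s:{0..t}|lborel. drift \<omega> s (X x s \<omega>))"
proof -
  interpret c: caratheodory_field "drift \<omega>" K by (rule caratheodory_field) fact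
  show ?thesis
    unfolding X_def by (rule c.picard_limit_solves) fact
qed

lemma X_solves_from:
  assumes "\<omega> \<in> space M" "0 \<le> t" "t \<le> s"
  shows "X x s \<omega> = X x t \<omega> + (LINT r:{t..s}|lborel. drift \<omega> r (X x r \<omega>))"
  using X_solves[of \<omega> s x] X_solves[of \<omega> t x] assms
    set_lborel_integral_combine[OF X_integrable[OF assms(1), of 0 s x], of t] by simp

lemma X_unique:
  assumes "\<omega> \<in> space M"
    and "\<And>t. 0 \<le> t \<Longrightarrow> set_integrable lborel {0..t} (\<lambda>s. drift \<omega> s (y s))"
    and "\<And>t. 0 \<le> t \<Longrightarrow> y t = x + (LINT s:{0..t}|lborel. drift \<omega> s (y s))"
    and "0 \<le> t"
  shows "y t = X x t \<omega>"
proof -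
  interpret c: caratheodory_field "drift \<omega>" K by (rule caratheodory_field) fact
  show ?thesis
    unfolding X_def by (rule c.solution_unique) fact+
qed

text \<open>Each Picard iterate is progressively measurable, since both the switched drift and the
  time integral preserve this property; the pointwise limit inherits it.\<close>

lemma X_prog: "prog_measurable_to F borel (X x)"
proof -
  have pic: "prog_measurable_to F borel (\<lambda>t \<omega>. picard (drift \<omega>) x n t)" for n
  proof (induction n)
    case 0
    then show ?case by (simp add: prog_measurable_to_def case_prod_beta)
  next
    case (Suc n)
    have "prog_measurable_to F borel (\<lambda>s \<omega>. drift \<omega> s (picard (drift \<omega>) x n s))"
      unfolding prog_measurable_to_def
    proof safe
      fix t :: real assume "0 \<le> t"
      then show "(\<lambda>(s, \<omega>). drift \<omega> s (picard (drift \<omega>) x n s)) \<in> borel_measurable (restrict_space borel {0..t} \<Otimes>\<^sub>M F t)"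
        using \<alpha>_prog b_prog Suc unfolding prog_measurable_to_def case_prod_beta
        by (intro borel_measurable_affine_switch) auto
    qed
    note int = prog_measurable_integral[OF this]
    show ?case
      unfolding prog_measurable_to_def
    proof (intro allI impI)
      fix t :: real assume "0 \<le> t"
      with int have "(\<lambda>(t, \<omega>). LINT s:{0..t}|lborel. drift \<omega> s (picard (drift \<omega>) x n s))
          \<in> borel_measurable (restrict_space borel {0..t} \<Otimes>\<^sub>M F t)"
        unfolding prog_measurable_to_def by blast
      then have "(\<lambda>y. x + (case y of (t, \<omega>) \<Rightarrow> LINT s:{0..t}|lborel. drift \<omega> s (picard (drift \<omega>) x n s)))
          \<in> borel_measurable (restrict_space borel {0..t} \<Otimes>\<^sub>M F t)"
        by (intro borel_measurable_add) simp_all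
      then show "(\<lambda>(t, \<omega>). picard (drift \<omega>) x (Suc n) t) \<in> borel_measurable (restrict_space borel {0..t} \<Otimes>\<^sub>M F t)"
        by (simp only: picard.simps case_prod_beta')
    qed
  qed
  show ?thesis
    unfolding prog_measurable_to_def
  proof safe
    fix t :: real assume t: "0 \<le> t"
    show "(\<lambda>(s, \<omega>). X x s \<omega>) \<in> borel_measurable (restrict_space borel {0..t} \<Otimes>\<^sub>M F t)"
    proof (rule borel_measurable_LIMSEQ_metric)
      show "(\<lambda>(s, \<omega>). picard (drift \<omega>) x n s) \<in> borel_measurable (restrict_space borel {0..t} \<Otimes>\<^sub>M F t)" for n
        using pic[of n] t by (simp add: prog_measurable_to_def)
      fix y assume "y \<in> space (restrict_space borel {0..t} \<Otimes>\<^sub>M F t)"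
      then have y: "0 \<le> fst y" "snd y \<in> space M"
        unfolding space_pair_measure space_restrict_space space_F[OF t] by auto
      show "(\<lambda>n. case y of (s, \<omega>) \<Rightarrow> picard (drift \<omega>) x n s) \<longlonglongrightarrow> (case y of (s, \<omega>) \<Rightarrow> X x s \<omega>)"
        unfolding X_def case_prod_beta
        by (rule caratheodory_field.picard_tendsto[OF caratheodory_field]) fact+
    qed
  qed
qed

lemma X_adapted: "0 \<le> t \<Longrightarrow> X x t \<in> borel_measurable (F t)"
  by (rule prog_measurable_adapted[OF X_prog])

lemma X_measurable [measurable]: "0 \<le> t \<Longrightarrow> X x t \<in> borel_measurable M"
  using measurable_from_subalg[OF subalgebra X_adapted] .

lemma \<alpha>_adapted: "0 \<le> t \<Longrightarrow> \<alpha> t \<in> measurable (F t) (count_space UNIV)"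
  by (rule prog_measurable_adapted[OF \<alpha>_prog])

lemma \<alpha>_measurable: "0 \<le> t \<Longrightarrow> \<alpha> t \<in> measurable M (count_space UNIV)"
  using measurable_from_subalg[OF subalgebra \<alpha>_adapted] .

lemma b_energy_measurable: "(\<lambda>\<omega>. LINT s:{0..t}|lborel. (norm (b s \<omega>))\<^sup>2) \<in> borel_measurable M" if "0 \<le> t"
proof -
  have "prog_measurable_to F borel (\<lambda>s \<omega>. (norm (b s \<omega>))\<^sup>2)"
    using b_prog unfolding prog_measurable_to_def case_prod_beta by auto
  from prog_measurable_adapted[OF prog_measurable_integral[OF this] that] show ?thesis
    by (rule measurable_from_subalg[OF subalgebra[OF that]])
qed

text \<open>Cumulative from time 0, so that the energy of a grid cell is a difference and the cell
  energies telescope along the grid.\<close>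

definition noise_energy :: "real \<Rightarrow> 'w \<Rightarrow> real" where
  "noise_energy t \<omega> = (LINT s:{0..t}|lborel. (norm (b s \<omega>))\<^sup>2)"

lemma noise_energy_diff:
  assumes "\<omega> \<in> space M" "0 \<le> t" "t \<le> s"
  shows "(LINT r:{t..s}|lborel. (norm (b r \<omega>))\<^sup>2) = noise_energy s \<omega> - noise_energy t \<omega>"
  using set_lborel_integral_combine[OF b_square_integrable_Icc[OF assms(1), of 0 s], of t] assms
  by (simp add: noise_energy_def)

lemma noise_energy_nonneg: "0 \<le> noise_energy t \<omega>"
  unfolding noise_energy_def set_lebesgue_integral_def by (intro integral_nonneg_AE) auto

lemma noise_energy_le:
  assumes "\<omega> \<in> space M"
  shows "ennreal (noise_energy t \<omega>) \<le> (\<integral>\<^sup>+s\<in>{0..}. ennreal ((norm (b s \<omega>))\<^sup>2) \<partial>lborel)"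
proof -
  have "ennreal (noise_energy t \<omega>) = (\<integral>\<^sup>+s. ennreal (indicator {0..t} s *\<^sub>R (norm (b s \<omega>))\<^sup>2) \<partial>lborel)"
    unfolding noise_energy_def set_lebesgue_integral_def
    using b_square_integrable_Icc[OF assms, of 0 t]
    by (intro nn_integral_eq_integral[symmetric]) (auto simp: set_integrable_def)
  also have "\<dots> \<le> (\<integral>\<^sup>+s\<in>{0..}. ennreal ((norm (b s \<omega>))\<^sup>2) \<partial>lborel)"
    by (intro nn_integral_mono) (auto simp: indicator_def)
  finally show ?thesis .
qed

lemma noise_energy_integrable:
  assumes "0 \<le> t"
  shows "integrable M (noise_energy t)"
proof (rule integrableI_nonneg)
  show "noise_energy t \<in> borel_measurable M"
    using b_energy_measurable[OF assms] unfolding noise_energy_def by simp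
  have "(\<integral>\<^sup>+\<omega>. ennreal (noise_energy t \<omega>) \<partial>M) \<le> (\<integral>\<^sup>+\<omega>. (\<integral>\<^sup>+s\<in>{0..}. ennreal ((norm (b s \<omega>))\<^sup>2) \<partial>lborel) \<partial>M)"
    by (intro nn_integral_mono noise_energy_le)
  then show "(\<integral>\<^sup>+\<omega>. ennreal (noise_energy t \<omega>) \<partial>M) < \<infinity>" using b_L2 by (rule le_less_trans)
qed (simp add: noise_energy_nonneg)

lemma noise_energy_expectation_bounded: "\<exists>C. \<forall>t\<ge>0. expectation (noise_energy t) \<le> C"
proof (intro exI allI impI)
  fix t :: real assume t: "0 \<le> t"
  let ?C = "\<integral>\<^sup>+\<omega>. (\<integral>\<^sup>+s\<in>{0..}. ennreal ((norm (b s \<omega>))\<^sup>2) \<partial>lborel) \<partial>M"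
  have "ennreal (expectation (noise_energy t)) = (\<integral>\<^sup>+\<omega>. ennreal (noise_energy t \<omega>) \<partial>M)"
    using noise_energy_integrable[OF t] by (intro nn_integral_eq_integral[symmetric]) (auto simp: noise_energy_nonneg)
  also have "\<dots> \<le> ?C" by (intro nn_integral_mono noise_energy_le)
  also have "\<dots> = ennreal (enn2real ?C)" using b_L2 by simp
  finally show "expectation (noise_energy t) \<le> enn2real ?C"
    by (simp add: ennreal_le_iff)
qed

lemma \<alpha>_change_measurable:
  assumes "\<omega> \<in> space M" "0 \<le> t"
  shows "set_borel_measurable lborel {t..u} (\<lambda>s. of_bool (\<alpha> s \<omega> \<noteq> \<alpha> t \<omega>) :: real)"
proof -
  have "(\<lambda>i. of_bool (i \<noteq> \<alpha> t \<omega>) :: real) \<in> borel_measurable (count_space UNIV)" by simp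
  from measurable_compose[OF \<alpha>_path[OF _ assms(1)] this]
  have "(\<lambda>s. indicator {t..u} s *\<^sub>R (of_bool (\<alpha> (max 0 s) \<omega> \<noteq> \<alpha> t \<omega>) :: real)) \<in> borel_measurable lborel"
    by (intro borel_measurable_scaleR) auto
  then show ?thesis
    unfolding set_borel_measurable_def
    by (rule measurable_cong[THEN iffD1, rotated]) (use assms(2) in \<open>auto simp: indicator_def max_def\<close>)
qed

lemmas X_step_premises =
  K_pos A_bound b_set_measurable b_square_integrable_Icc \<alpha>_change_measurable X_integrable X_solves_from

lemma X_square_step:
  assumes "\<omega> \<in> space M" "0 \<le> t" "0 < h" "2 * K * h \<le> 1" "t \<le> s" "s \<le> t + h"
  shows "(norm (X x s \<omega>))\<^sup>2 \<le> 8 * ((norm (X x t \<omega>))\<^sup>2 + h * (noise_energy (t + h) \<omega> - noise_energy t \<omega>))"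
proof -
  have "(norm (X x s \<omega>))\<^sup>2 \<le> 8 * ((norm (X x t \<omega>))\<^sup>2 + h * (LINT r:{t..t+h}|lborel. (norm (b r \<omega>))\<^sup>2))"
    using assms by (intro step_square_bound[where a="\<lambda>s. \<alpha> s \<omega>" and A=A and K=K] X_step_premises) auto
  then show ?thesis using noise_energy_diff[of \<omega> t "t + h"] assms by simp
qed

definition time_away :: "real \<Rightarrow> real \<Rightarrow> 'w \<Rightarrow> real" where
  "time_away t h \<omega> = (LINT s:{t..t+h}|lborel. of_bool (\<alpha> s \<omega> \<noteq> \<alpha> t \<omega>))"

lemma X_quadratic_step:
  assumes "\<omega> \<in> space M" "0 \<le> t" "0 < h" "2 * K * h \<le> 1"
    and "0 < \<kappa>" "\<And>i v. norm (P i *v v) \<le> \<kappa> * norm v" "\<And>i. transpose (P i) = P i" "0 < \<epsilon>"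
  shows "X x (t + h) \<omega> \<bullet> (P i *v X x (t + h) \<omega>) \<le> X x t \<omega> \<bullet> (P i *v X x t \<omega>)
     + 2 * h * ((P (\<alpha> t \<omega>) *v X x t \<omega>) \<bullet> (A (\<alpha> t \<omega>) *v X x t \<omega>))
     + (norm (X x t \<omega>))\<^sup>2 * (4 * h * \<kappa> * K * of_bool (i \<noteq> \<alpha> t \<omega>) + 4 * \<kappa> * K * time_away t h \<omega>
          + 42 * \<kappa> * K\<^sup>2 * h\<^sup>2 + 4 * \<kappa> * \<epsilon> * h)
     + \<kappa> * (1 / \<epsilon> + 16 * h) * (noise_energy (t + h) \<omega> - noise_energy t \<omega>)"
proof -
  have "noise_energy (t + h) \<omega> - noise_energy t \<omega> = (LINT r:{t..t+h}|lborel. (norm (b r \<omega>))\<^sup>2)"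
    using noise_energy_diff[of \<omega> t "t + h"] assms by simp
  then show ?thesis
    unfolding time_away_def using assms
    by (simp only:) (intro step_quadratic[where a="\<lambda>s. \<alpha> s \<omega>" and A=A and K=K and b="\<lambda>s. b s \<omega>"
        and X="\<lambda>s. X x s \<omega>"] X_step_premises; simp)
qed

lemma time_away_bounds:
  assumes "\<omega> \<in> space M" "0 \<le> t" "0 < h"
  shows "0 \<le> time_away t h \<omega>" "time_away t h \<omega> \<le> h"
  unfolding time_away_def
  using set_integral_of_bool_Icc(2,3)[OF less_imp_le[OF assms(3)] \<alpha>_change_measurable[OF assms(1,2)]]
  by auto

end

section \<open>The Lyapunov function in expectation\<close>

lemma (in finite_measure) integrable_mult_bounded:
  fixes Z \<phi> :: "'a \<Rightarrow> real"
  assumes "integrable M Z" "\<phi> \<in> borel_measurable M" "\<And>\<omega>. \<omega> \<in> space M \<Longrightarrow> \<bar>\<phi> \<omega>\<bar> \<le> c"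
  shows "integrable M (\<lambda>\<omega>. Z \<omega> * \<phi> \<omega>)"
proof (rule Bochner_Integration.integrable_bound)
  show "integrable M (\<lambda>\<omega>. c * Z \<omega>)" using assms(1) by simp
  show "(\<lambda>\<omega>. Z \<omega> * \<phi> \<omega>) \<in> borel_measurable M" using assms(1,2) by simp
  show "AE \<omega> in M. norm (Z \<omega> * \<phi> \<omega>) \<le> norm (c * Z \<omega>)"
  proof (rule AE_I2)
    fix \<omega> assume "\<omega> \<in> space M"
    then have "\<bar>\<phi> \<omega>\<bar> \<le> \<bar>c\<bar>" using assms(3)[of \<omega>] by linarith
    then show "norm (Z \<omega> * \<phi> \<omega>) \<le> norm (c * Z \<omega>)"
      using mult_right_mono[of "\<bar>\<phi> \<omega>\<bar>" "\<bar>c\<bar>" "\<bar>Z \<omega>\<bar>"] by (simp add: abs_mult mult.commute)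
  qed
qed

lemma abs_le_sum_abs:
  fixes g :: "'s::finite \<Rightarrow> real"
  shows "\<bar>g i\<bar> \<le> (\<Sum>i\<in>UNIV. \<bar>g i\<bar>)"
  by (rule member_le_sum) auto

context switched_linear_system
begin

lemma integrable_mult_state:
  fixes g :: "'s \<Rightarrow> real"
  assumes "integrable M Z" "0 \<le> t"
  shows "integrable M (\<lambda>\<omega>. Z \<omega> * g (\<alpha> t \<omega>))"
  using measurable_compose[OF \<alpha>_measurable[OF assms(2)], of g borel] abs_le_sum_abs[of g]
  by (intro integrable_mult_bounded[OF assms(1)]) auto

lemma change_measurable:
  assumes "0 \<le> s" "0 \<le> t"
  shows "(\<lambda>\<omega>. of_bool (\<alpha> s \<omega> \<noteq> \<alpha> t \<omega>) :: real) \<in> borel_measurable M"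
proof -
  have "(\<lambda>\<omega>. of_bool (i \<noteq> \<alpha> t \<omega>) :: real) \<in> borel_measurable M" for i
    using measurable_compose[OF \<alpha>_measurable[OF assms(2)], of "\<lambda>j. of_bool (i \<noteq> j)" borel] by simp
  from measurable_compose_countable[OF this \<alpha>_measurable[OF assms(1)]] show ?thesis .
qed

lemma integrable_change:
  fixes Z :: "'w \<Rightarrow> real"
  assumes "integrable M Z" "0 \<le> s" "0 \<le> t"
  shows "integrable M (\<lambda>\<omega>. Z \<omega> * of_bool (\<alpha> s \<omega> \<noteq> \<alpha> t \<omega>))"
  using change_measurable[OF assms(2,3)] by (intro integrable_mult_bounded[OF assms(1), of _ 1]) auto

lemma change_joint:
  assumes "0 \<le> t"
  shows "(\<lambda>(s, \<omega>). of_bool (\<alpha> (max 0 s) \<omega> \<noteq> \<alpha> t \<omega>) :: real) \<in> borel_measurable (lborel \<Otimes>\<^sub>M M)"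
proof -
  have 1: "(\<lambda>x. \<alpha> (max 0 (fst x)) (snd x)) \<in> measurable (lborel \<Otimes>\<^sub>M M) (count_space UNIV)"
    using prog_measurable_joint[OF \<alpha>_prog ident_measurable]
    by (simp add: case_prod_beta cong: measurable_cong_sets)
  have 2: "(\<lambda>x. \<alpha> t (snd x)) \<in> measurable (lborel \<Otimes>\<^sub>M M) (count_space UNIV)"
    by (rule measurable_compose[OF measurable_snd \<alpha>_measurable[OF assms]])
  have "(\<lambda>x. of_bool (i \<noteq> \<alpha> t (snd x)) :: real) \<in> borel_measurable (lborel \<Otimes>\<^sub>M M)" for i
    using measurable_compose[OF 2, of "\<lambda>j. of_bool (i \<noteq> j)" borel] by simp
  from measurable_compose_countable[OF this 1] show ?thesis by (simp only: case_prod_beta')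
qed

text \<open>Fubini exchanges the expectation with the time integral that defines
  \<open>time_away\<close>. A bound at each single time of the step therefore suffices, and the
  length of the step supplies the factor \<open>h\<close>.\<close>

lemma expected_time_away:
  assumes "0 \<le> t" "0 < h" "integrable M Z" "\<And>\<omega>. 0 \<le> Z \<omega>"
    and c: "\<And>s. t \<le> s \<Longrightarrow> s \<le> t + h \<Longrightarrow> expectation (\<lambda>\<omega>. Z \<omega> * of_bool (\<alpha> s \<omega> \<noteq> \<alpha> t \<omega>)) \<le> c"
  shows "integrable M (\<lambda>\<omega>. Z \<omega> * time_away t h \<omega>)" "expectation (\<lambda>\<omega>. Z \<omega> * time_away t h \<omega>) \<le> h * c"
proof -
  interpret pair_sigma_finite lborel M ..
  let ?D = "\<lambda>s \<omega>. of_bool (\<alpha> s \<omega> \<noteq> \<alpha> t \<omega>) :: real"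
  have Z: "Z \<in> borel_measurable M" using assms(3) by simp
  \<comment> \<open>The bound at the left end point \<open>s = t\<close> already forces
    \<open>c\<close> to be nonnegative, which the passage through extended nonnegative reals
    requires.\<close>
  have c0: "0 \<le> c"
  proof -
    have "0 \<le> expectation (\<lambda>\<omega>. Z \<omega> * ?D t \<omega>)" by simp
    then show ?thesis using c[of t] assms by simp
  qed
  have joint: "(\<lambda>(s, \<omega>). indicator {t..t+h} s * ?D (max 0 s) \<omega>) \<in> borel_measurable (lborel \<Otimes>\<^sub>M M)"
  proof -
    have "(\<lambda>x. indicator {t..t+h} (fst x) :: real) \<in> borel_measurable (lborel \<Otimes>\<^sub>M M)" by measurable
    from borel_measurable_times[OF this change_joint[OF assms(1)]] show ?thesis
      by (simp only: case_prod_beta')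
  qed
  have joint': "(\<lambda>(\<omega>, s). indicator {t..t+h} s * ?D (max 0 s) \<omega>) \<in> borel_measurable (M \<Otimes>\<^sub>M lborel)"
    using measurable_compose[OF measurable_pair_swap' joint] by (simp add: case_prod_beta)
  have time_away_eq: "time_away t h \<omega> = (LINT s|lborel. indicator {t..t+h} s * ?D (max 0 s) \<omega>)" for \<omega>
    unfolding time_away_def set_lebesgue_integral_def using assms(1)
    by (intro Bochner_Integration.integral_cong) (auto simp: indicator_def max_def)
  have time_away_meas: "time_away t h \<in> borel_measurable M"
    unfolding time_away_eq[abs_def] using joint' by (rule lborel.borel_measurable_lebesgue_integral)
  show int: "integrable M (\<lambda>\<omega>. Z \<omega> * time_away t h \<omega>)"
    using time_away_bounds[OF _ assms(1,2)] time_away_meas by (intro integrable_mult_bounded[OF assms(3), of _ h]) auto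
  have Jn: "ennreal (time_away t h \<omega>) = (\<integral>\<^sup>+s. ennreal (indicator {t..t+h} s * ?D (max 0 s) \<omega>) \<partial>lborel)"
    if "\<omega> \<in> space M" for \<omega>
  proof -
    have "integrable lborel (\<lambda>s. indicator {t..t+h} s * ?D (max 0 s) \<omega>)"
    proof (rule Bochner_Integration.integrable_bound)
      show "integrable lborel (\<lambda>s. indicator {t..t+h} s :: real)"
        by (rule integrable_real_indicator) (auto simp: emeasure_lborel_Icc_eq)
      show "(\<lambda>s. indicator {t..t+h} s * ?D (max 0 s) \<omega>) \<in> borel_measurable lborel"
        using measurable_compose[OF measurable_Pair2'[OF that, of lborel] joint] by simp
    qed (auto simp: indicator_def)
    then show ?thesis unfolding time_away_eq by (intro nn_integral_eq_integral[symmetric]) auto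
  qed
  have "ennreal (expectation (\<lambda>\<omega>. Z \<omega> * time_away t h \<omega>)) = (\<integral>\<^sup>+\<omega>. ennreal (Z \<omega> * time_away t h \<omega>) \<partial>M)"
    using int time_away_bounds(1)[OF _ assms(1,2)] assms(4)
    by (intro nn_integral_eq_integral[symmetric]) auto
  also have "\<dots> = (\<integral>\<^sup>+\<omega>. (\<integral>\<^sup>+s. ennreal (Z \<omega> * (indicator {t..t+h} s * ?D (max 0 s) \<omega>)) \<partial>lborel) \<partial>M)"
  proof (intro nn_integral_cong)
    fix \<omega> assume w: "\<omega> \<in> space M"
    have "(\<lambda>s. indicator {t..t+h} s * ?D (max 0 s) \<omega>) \<in> borel_measurable lborel"
      using measurable_compose[OF measurable_Pair2'[OF w, of lborel] joint] by simp
    then have "(\<integral>\<^sup>+s. ennreal (Z \<omega>) * ennreal (indicator {t..t+h} s * ?D (max 0 s) \<omega>) \<partial>lborel)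
        = ennreal (Z \<omega>) * (\<integral>\<^sup>+s. ennreal (indicator {t..t+h} s * ?D (max 0 s) \<omega>) \<partial>lborel)"
      by (intro nn_integral_cmult) auto
    then show "ennreal (Z \<omega> * time_away t h \<omega>)
        = (\<integral>\<^sup>+s. ennreal (Z \<omega> * (indicator {t..t+h} s * ?D (max 0 s) \<omega>)) \<partial>lborel)"
      using Jn[OF w] assms(4) time_away_bounds(1)[OF w assms(1,2)] by (simp add: ennreal_mult)
  qed
  also have "\<dots> = (\<integral>\<^sup>+s. (\<integral>\<^sup>+\<omega>. ennreal (Z \<omega> * (indicator {t..t+h} s * ?D (max 0 s) \<omega>)) \<partial>M) \<partial>lborel)"
  proof (rule Fubini')
    have "(\<lambda>x. Z (snd x) * (indicator {t..t+h} (fst x) * ?D (max 0 (fst x)) (snd x))) \<in> borel_measurable (lborel \<Otimes>\<^sub>M M)"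
      using borel_measurable_times[OF measurable_compose[OF measurable_snd Z] joint]
      by (simp only: case_prod_beta')
    then show "(\<lambda>(s, \<omega>). ennreal (Z \<omega> * (indicator {t..t+h} s * ?D (max 0 s) \<omega>))) \<in> borel_measurable (lborel \<Otimes>\<^sub>M M)"
      by (simp add: case_prod_beta)
  qed
  also have "\<dots> \<le> (\<integral>\<^sup>+s. ennreal c * indicator {t..t+h} s \<partial>lborel)"
  proof (intro nn_integral_mono)
    fix s :: real
    show "(\<integral>\<^sup>+\<omega>. ennreal (Z \<omega> * (indicator {t..t+h} s * ?D (max 0 s) \<omega>)) \<partial>M) \<le> ennreal c * indicator {t..t+h} s"
    proof (cases "s \<in> {t..t+h}")
      case True
      then have "(\<integral>\<^sup>+\<omega>. ennreal (Z \<omega> * ?D s \<omega>) \<partial>M) = ennreal (expectation (\<lambda>\<omega>. Z \<omega> * ?D s \<omega>))"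
        using assms by (intro nn_integral_eq_integral integrable_change) auto
      then show ?thesis using True c[of s] assms(1) by (simp add: ennreal_leI max_def)
    qed simp
  qed
  also have "\<dots> = ennreal c * emeasure lborel {t..t+h}"
    by (rule nn_integral_cmult_indicator) simp
  also have "\<dots> = ennreal (h * c)"
    using assms(2) c0 by (simp add: ennreal_mult mult.commute)
  finally show "expectation (\<lambda>\<omega>. Z \<omega> * time_away t h \<omega>) \<le> h * c"
    using assms(2) c0 by (simp add: ennreal_le_iff)
qed

end

section \<open>One-step transitions of the chain under the expectation\<close>

locale markov_switched_linear_system = switched_linear_system M F \<alpha> A b K
  for M :: "'w measure" and F and \<alpha> :: "real \<Rightarrow> 'w \<Rightarrow> 's::finite"
    and A :: "'s \<Rightarrow> real^'n^'n" and b K +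
  fixes p :: "real \<Rightarrow> real^'s^'s"
  assumes markov: "\<And>s t j. 0 \<le> s \<Longrightarrow> s \<le> t \<Longrightarrow>
      AE \<omega> in M. real_cond_exp M (F s) (indicator {\<omega> \<in> space M. \<alpha> t \<omega> = j}) \<omega> = p (t - s) $ \<alpha> s \<omega> $ j"
begin

text \<open>The defining property of conditional expectation, with the \<open>F s\<close>-measurable
  weight \<open>Z\<close> as test function. All later use of the Markov property passes through this
  identity.\<close>

lemma expectation_transition:
  assumes "0 \<le> s" "s \<le> t" and Z: "Z \<in> borel_measurable (F s)" "integrable M Z"
  shows "expectation (\<lambda>\<omega>. Z \<omega> * of_bool (\<alpha> t \<omega> = j)) = expectation (\<lambda>\<omega>. Z \<omega> * p (t - s) $ \<alpha> s \<omega> $ j)"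
proof -
  interpret finite_measure_subalgebra M "F s"
    by standard (rule subalgebra[OF assms(1)])
  let ?S = "{\<omega> \<in> space M. \<alpha> t \<omega> = j}"
  have "?S = \<alpha> t -` {j} \<inter> space M" by auto
  then have S: "?S \<in> sets M" using \<alpha>_measurable[of t] assms by (simp add: measurable_sets)
  have eq: "Z \<omega> * indicator ?S \<omega> = Z \<omega> * of_bool (\<alpha> t \<omega> = j)" if "\<omega> \<in> space M" for \<omega>
    using that by (simp add: indicator_def)
  have "integrable M (\<lambda>\<omega>. Z \<omega> * of_bool (\<alpha> t \<omega> = j))"
    using assms by (intro integrable_mult_state) auto
  then have "integrable M (\<lambda>\<omega>. Z \<omega> * indicator ?S \<omega>)"
    by (rule Bochner_Integration.integrable_cong[THEN iffD1, rotated 2]) (simp_all add: eq)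
  then have "expectation (\<lambda>\<omega>. Z \<omega> * real_cond_exp M (F s) (indicator ?S) \<omega>) = expectation (\<lambda>\<omega>. Z \<omega> * indicator ?S \<omega>)"
    using S Z(1) by (intro real_cond_exp_intg) auto
  also have "\<dots> = expectation (\<lambda>\<omega>. Z \<omega> * of_bool (\<alpha> t \<omega> = j))"
    by (intro Bochner_Integration.integral_cong) (simp_all add: eq)
  finally have "expectation (\<lambda>\<omega>. Z \<omega> * real_cond_exp M (F s) (indicator ?S) \<omega>)
    = expectation (\<lambda>\<omega>. Z \<omega> * of_bool (\<alpha> t \<omega> = j))" .
  moreover have "expectation (\<lambda>\<omega>. Z \<omega> * real_cond_exp M (F s) (indicator ?S) \<omega>)
      = expectation (\<lambda>\<omega>. Z \<omega> * p (t - s) $ \<alpha> s \<omega> $ j)"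
  proof (rule integral_cong_AE)
    show "(\<lambda>\<omega>. Z \<omega> * p (t - s) $ \<alpha> s \<omega> $ j) \<in> borel_measurable M"
      using integrable_mult_state[OF Z(2) assms(1), of "\<lambda>i. p (t - s) $ i $ j"] by simp
    show "AE \<omega> in M. Z \<omega> * real_cond_exp M (F s) (indicator ?S) \<omega> = Z \<omega> * p (t - s) $ \<alpha> s \<omega> $ j"
      using markov[OF assms(1,2), of j] by eventually_elim simp
  qed (use Z in simp)
  ultimately show ?thesis by simp
qed

text \<open>Given the state \<open>i\<close> at time \<open>s\<close>, the conditional probability
  of a different state at \<open>t\<close> is \<open>1 - p (t - s) $ i $ i\<close>. The weight is
  split over the events \<open>\<alpha> s \<omega> = i\<close> because the transition identity
  handles one fixed target state at a time.\<close>

lemma expectation_change_le: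
  assumes "0 \<le> s" "s \<le> t" and Z: "Z \<in> borel_measurable (F s)" "integrable M Z" "\<And>\<omega>. 0 \<le> Z \<omega>"
    and c: "\<And>i. 1 - p (t - s) $ i $ i \<le> c"
  shows "expectation (\<lambda>\<omega>. Z \<omega> * of_bool (\<alpha> t \<omega> \<noteq> \<alpha> s \<omega>)) \<le> c * expectation Z"
proof -
  have t: "0 \<le> t" using assms by simp
  let ?Zi = "\<lambda>i \<omega>. Z \<omega> * of_bool (\<alpha> s \<omega> = i)"
  have Zi: "?Zi i \<in> borel_measurable (F s)" "integrable M (?Zi i)" for i
  proof -
    have "(\<lambda>\<omega>. of_bool (\<alpha> s \<omega> = i) :: real) \<in> borel_measurable (F s)"
      using measurable_compose[OF \<alpha>_adapted[OF assms(1)], of "\<lambda>j. of_bool (j = i)" borel] by simp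
    then show "?Zi i \<in> borel_measurable (F s)" by (rule borel_measurable_times[OF Z(1)])
    show "integrable M (?Zi i)" by (rule integrable_mult_state[OF Z(2) assms(1)])
  qed
  have int1: "integrable M (\<lambda>\<omega>. ?Zi i \<omega> * of_bool (\<alpha> t \<omega> = i))" for i
    by (rule integrable_mult_state[OF Zi(2) t])
  have int2: "integrable M (\<lambda>\<omega>. ?Zi i \<omega> * p (t - s) $ \<alpha> s \<omega> $ i)" for i
    using integrable_mult_state[OF Zi(2) assms(1), of i "\<lambda>j. p (t - s) $ j $ i"] .
  have "(\<Sum>i\<in>UNIV. ?Zi i \<omega> * of_bool (\<alpha> t \<omega> = i)) = Z \<omega> * of_bool (\<alpha> t \<omega> = \<alpha> s \<omega>)" for \<omega>
  proof -
    have "(\<Sum>i\<in>UNIV. ?Zi i \<omega> * of_bool (\<alpha> t \<omega> = i)) = (\<Sum>i\<in>UNIV. if i = \<alpha> s \<omega> then Z \<omega> * of_bool (\<alpha> t \<omega> = \<alpha> s \<omega>) else 0)"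
      by (intro sum.cong) auto
    then show ?thesis by simp
  qed
  then have eq: "Z \<omega> * of_bool (\<alpha> t \<omega> \<noteq> \<alpha> s \<omega>) = Z \<omega> - (\<Sum>i\<in>UNIV. ?Zi i \<omega> * of_bool (\<alpha> t \<omega> = i))" for \<omega>
    by simp
  have "expectation (\<lambda>\<omega>. Z \<omega> * of_bool (\<alpha> t \<omega> \<noteq> \<alpha> s \<omega>))
      = expectation Z - (\<Sum>i\<in>UNIV. expectation (\<lambda>\<omega>. ?Zi i \<omega> * of_bool (\<alpha> t \<omega> = i)))"
    by (simp only: eq Bochner_Integration.integral_diff[OF Z(2) Bochner_Integration.integrable_sum[OF int1]]
        Bochner_Integration.integral_sum[OF int1])
  also have "\<dots> = expectation Z - (\<Sum>i\<in>UNIV. expectation (\<lambda>\<omega>. ?Zi i \<omega> * p (t - s) $ \<alpha> s \<omega> $ i))"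
    using expectation_transition[OF assms(1,2) Zi] by simp
  also have "\<dots> = expectation (\<lambda>\<omega>. Z \<omega> - (\<Sum>i\<in>UNIV. ?Zi i \<omega> * p (t - s) $ \<alpha> s \<omega> $ i))"
    by (simp only: Bochner_Integration.integral_diff[OF Z(2) Bochner_Integration.integrable_sum[OF int2]]
        Bochner_Integration.integral_sum[OF int2])
  also have "\<dots> \<le> expectation (\<lambda>\<omega>. c * Z \<omega>)"
  proof (rule integral_mono)
    show "integrable M (\<lambda>\<omega>. Z \<omega> - (\<Sum>i\<in>UNIV. ?Zi i \<omega> * p (t - s) $ \<alpha> s \<omega> $ i))"
      using Z(2) int2 by (intro Bochner_Integration.integrable_diff Bochner_Integration.integrable_sum)
    fix \<omega>
    have "(\<Sum>i\<in>UNIV. ?Zi i \<omega> * p (t - s) $ \<alpha> s \<omega> $ i)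
        = (\<Sum>i\<in>UNIV. if i = \<alpha> s \<omega> then Z \<omega> * p (t - s) $ \<alpha> s \<omega> $ \<alpha> s \<omega> else 0)"
      by (intro sum.cong) auto
    then have "Z \<omega> - (\<Sum>i\<in>UNIV. ?Zi i \<omega> * p (t - s) $ \<alpha> s \<omega> $ i) = (1 - p (t - s) $ \<alpha> s \<omega> $ \<alpha> s \<omega>) * Z \<omega>"
      by (simp add: algebra_simps)
    also have "\<dots> \<le> c * Z \<omega>" using c Z(3) by (intro mult_right_mono) auto
    finally show "Z \<omega> - (\<Sum>i\<in>UNIV. ?Zi i \<omega> * p (t - s) $ \<alpha> s \<omega> $ i) \<le> c * Z \<omega>" .
  qed (use Z in simp)
  finally show ?thesis by simp
qed


lemma X_square_integrable_step:
  assumes "0 \<le> t" "0 < h" "2 * K * h \<le> 1" "integrable M (\<lambda>\<omega>. (norm (X x t \<omega>))\<^sup>2)"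
  shows "integrable M (\<lambda>\<omega>. (norm (X x (t + h) \<omega>))\<^sup>2)"
proof (rule Bochner_Integration.integrable_bound)
  show "integrable M (\<lambda>\<omega>. 8 * ((norm (X x t \<omega>))\<^sup>2 + h * (noise_energy (t + h) \<omega> - noise_energy t \<omega>)))"
    using assms
    by (intro integrable_mult_right Bochner_Integration.integrable_add Bochner_Integration.integrable_diff
        noise_energy_integrable) auto
  show "(\<lambda>\<omega>. (norm (X x (t + h) \<omega>))\<^sup>2) \<in> borel_measurable M"
    using X_measurable[of "t + h" x] assms by simp
  show "AE \<omega> in M. norm ((norm (X x (t + h) \<omega>))\<^sup>2) \<le> norm (8 * ((norm (X x t \<omega>))\<^sup>2 + h * (noise_energy (t + h) \<omega> - noise_energy t \<omega>)))"
  proof (rule AE_I2)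
    fix \<omega> assume "\<omega> \<in> space M"
    then have "(norm (X x (t + h) \<omega>))\<^sup>2 \<le> 8 * ((norm (X x t \<omega>))\<^sup>2 + h * (noise_energy (t + h) \<omega> - noise_energy t \<omega>))"
      using assms by (intro X_square_step) auto
    then show "norm ((norm (X x (t + h) \<omega>))\<^sup>2) \<le> norm (8 * ((norm (X x t \<omega>))\<^sup>2 + h * (noise_energy (t + h) \<omega> - noise_energy t \<omega>)))"
      unfolding real_norm_def abs_of_nonneg[OF zero_le_power2] by (rule order_trans[OF _ abs_ge_self])
  qed
qed

lemma inner_matrix_bound:
  fixes B C :: "real^'n^'n"
  assumes "\<And>v. norm (B *v v) \<le> c * norm v" "\<And>v. norm (C *v v) \<le> d * norm v" "0 \<le> d"
  shows "\<bar>(B *v v) \<bullet> (C *v v)\<bar> \<le> c * d * (norm v)\<^sup>2"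
proof -
  have "\<bar>(B *v v) \<bullet> (C *v v)\<bar> \<le> norm (B *v v) * norm (C *v v)" by (rule Cauchy_Schwarz_ineq2)
  also have "\<dots> \<le> (c * norm v) * (d * norm v)"
    using assms by (intro mult_mono order_trans[OF norm_ge_zero assms(1)]) auto
  finally show ?thesis by (simp add: power2_eq_square ac_simps)
qed

lemma quadratic_measurable:
  fixes P R :: "'s \<Rightarrow> real^'n^'n"
  assumes "a \<in> measurable N (count_space UNIV)" "u \<in> borel_measurable N"
  shows "(\<lambda>\<omega>. (R (a \<omega>) *v u \<omega>) \<bullet> (P (a \<omega>) *v u \<omega>)) \<in> borel_measurable N"
  using borel_measurable_affine_switch[OF assms, of "\<lambda>_. 0" R] borel_measurable_affine_switch[OF assms, of "\<lambda>_. 0" P]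
  by simp

definition lyapunov :: "('s \<Rightarrow> real^'n^'n) \<Rightarrow> real^'n \<Rightarrow> real \<Rightarrow> real" where
  "lyapunov P x t = expectation (\<lambda>\<omega>. X x t \<omega> \<bullet> (P (\<alpha> t \<omega>) *v X x t \<omega>))"

text \<open>Two matrix families are allowed so that \<open>R i = mat 1\<close> covers the Lyapunov
  form, while the pair \<open>P\<close>, \<open>A\<close> covers the drift term.\<close>

lemma quadratic_integrable:
  fixes P R :: "'s \<Rightarrow> real^'n^'n"
  assumes "0 \<le> t" "integrable M (\<lambda>\<omega>. (norm (X x t \<omega>))\<^sup>2)" "0 \<le> d"
    and "\<And>i v. norm (R i *v v) \<le> c * norm v" "\<And>i v. norm (P i *v v) \<le> d * norm v"
  shows "integrable M (\<lambda>\<omega>. (R (\<alpha> t \<omega>) *v X x t \<omega>) \<bullet> (P (\<alpha> t \<omega>) *v X x t \<omega>))"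
proof (rule Bochner_Integration.integrable_bound)
  show "integrable M (\<lambda>\<omega>. c * d * (norm (X x t \<omega>))\<^sup>2)" using assms by simp
  show "(\<lambda>\<omega>. (R (\<alpha> t \<omega>) *v X x t \<omega>) \<bullet> (P (\<alpha> t \<omega>) *v X x t \<omega>)) \<in> borel_measurable M"
    using assms(1) by (intro quadratic_measurable \<alpha>_measurable X_measurable)
  show "AE \<omega> in M. norm ((R (\<alpha> t \<omega>) *v X x t \<omega>) \<bullet> (P (\<alpha> t \<omega>) *v X x t \<omega>)) \<le> norm (c * d * (norm (X x t \<omega>))\<^sup>2)"
    unfolding real_norm_def
    by (intro AE_I2 order_trans[OF inner_matrix_bound abs_ge_self] assms)
qed

text \<open>On the Lyapunov function the chain enters only through one-step transition probabilities: a change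
  of state during the step has probability of order \<open>h\<close>, so freezing the coefficient \<open>A\<close> at time \<open>t\<close>
  costs only order \<open>h\<^sup>2\<close>.\<close>

lemma lyapunov_step:
  assumes t: "0 \<le> t" and h: "0 < h" "2 * K * h \<le> 1"
    and int: "integrable M (\<lambda>\<omega>. (norm (X x t \<omega>))\<^sup>2)"
    and \<kappa>: "0 < \<kappa>" "\<And>i v. norm (P i *v v) \<le> \<kappa> * norm v" and sym: "\<And>i. transpose (P i) = P i"
    and "0 < \<epsilon>" "0 \<le> e"
    and q: "\<And>s i. 0 \<le> s \<Longrightarrow> s \<le> h \<Longrightarrow> 1 - p s $ i $ i \<le> q * h"
    and gen: "\<And>i j. \<bar>p h $ i $ j - of_bool (i = j) - h * Q $ i $ j\<bar> \<le> e * h"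
    and neg: "\<And>i v. 2 * ((P i *v v) \<bullet> (A i *v v)) + (\<Sum>j\<in>UNIV. Q $ i $ j * (v \<bullet> (P j *v v))) \<le> - \<delta> * (norm v)\<^sup>2"
  shows "lyapunov P x (t + h) \<le> lyapunov P x t
     + h * (- \<delta> + real CARD('s) * \<kappa> * e + 8 * \<kappa> * K * q * h + 42 * \<kappa> * K\<^sup>2 * h + 4 * \<kappa> * \<epsilon>)
         * expectation (\<lambda>\<omega>. (norm (X x t \<omega>))\<^sup>2)
     + \<kappa> * (1 / \<epsilon> + 16 * h) * (expectation (noise_energy (t + h)) - expectation (noise_energy t))"
proof -
  define \<eta> where "\<eta> \<omega> = (norm (X x t \<omega>))\<^sup>2" for \<omega>
  \<comment> \<open>The form with the weight of a fixed state \<open>j\<close> at the position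
    \<open>X x t\<close> is known at time \<open>t\<close>, so it may serve as the weight when
    conditioning on the past.\<close>
  define w where "w j \<omega> = X x t \<omega> \<bullet> (P j *v X x t \<omega>)" for j \<omega>
  define m where "m \<omega> = (P (\<alpha> t \<omega>) *v X x t \<omega>) \<bullet> (A (\<alpha> t \<omega>) *v X x t \<omega>)" for \<omega>
  let ?D = "\<lambda>s \<omega>. of_bool (\<alpha> s \<omega> \<noteq> \<alpha> t \<omega>) :: real"
  let ?pw = "\<lambda>\<omega>. \<Sum>j\<in>UNIV. w j \<omega> * p h $ \<alpha> t \<omega> $ j"
  have th: "0 \<le> t + h" using t h by simp
  have int_next: "integrable M (\<lambda>\<omega>. (norm (X x (t + h) \<omega>))\<^sup>2)"
    by (rule X_square_integrable_step) fact+
  have \<eta>: "integrable M \<eta>" "\<eta> \<in> borel_measurable (F t)" "\<And>\<omega>. 0 \<le> \<eta> \<omega>"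
    using int X_adapted[OF t, of x] unfolding \<eta>_def by auto
  have w_bound: "\<bar>w j \<omega>\<bar> \<le> \<kappa> * \<eta> \<omega>" for j \<omega>
    using inner_matrix_bound[of "mat 1" 1 "P j" \<kappa> "X x t \<omega>"] \<kappa> by (simp add: w_def \<eta>_def)
  have w: "integrable M (w j)" "w j \<in> borel_measurable (F t)" for j
    using quadratic_integrable[OF t int, of \<kappa> "\<lambda>_. mat 1" 1 "\<lambda>_. P j"] \<kappa>
      quadratic_measurable[OF \<alpha>_adapted X_adapted, OF t t, of "\<lambda>_. mat 1" x "\<lambda>_. P j"]
    by (simp_all add: w_def[abs_def])
  have V_int: "integrable M (\<lambda>\<omega>. X x s \<omega> \<bullet> (P (\<alpha> s \<omega>) *v X x s \<omega>))"
    if "0 \<le> s" "integrable M (\<lambda>\<omega>. (norm (X x s \<omega>))\<^sup>2)" for s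
    using quadratic_integrable[OF that, of \<kappa> "\<lambda>_. mat 1" 1 P] \<kappa> by simp
  have m: "integrable M m"
    unfolding m_def by (rule quadratic_integrable[OF t int _ \<kappa>(2) A_bound]) (use K_pos in simp)
  have D_le: "expectation (\<lambda>\<omega>. \<eta> \<omega> * ?D s \<omega>) \<le> q * h * expectation \<eta>" if "t \<le> s" "s \<le> t + h" for s
    using that by (intro expectation_change_le t \<eta> q) auto
  have D_int: "integrable M (\<lambda>\<omega>. \<eta> \<omega> * ?D (t + h) \<omega>)" by (rule integrable_change[OF \<eta>(1) th t])
  have J_int: "integrable M (\<lambda>\<omega>. \<eta> \<omega> * time_away t h \<omega>)"
    and J_le: "expectation (\<lambda>\<omega>. \<eta> \<omega> * time_away t h \<omega>) \<le> h * (q * h * expectation \<eta>)"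
    using expected_time_away[OF t h(1) \<eta>(1,3) D_le] by auto
  have w1: "integrable M (\<lambda>\<omega>. w j \<omega> * of_bool (\<alpha> (t + h) \<omega> = j))" for j
    by (rule integrable_mult_state[OF w(1) th])
  have w2: "integrable M (\<lambda>\<omega>. w j \<omega> * p h $ \<alpha> t \<omega> $ j)" for j
    by (rule integrable_mult_state[OF w(1) t, where g="\<lambda>i. p h $ i $ j"])
  have noise_energy: "integrable M (noise_energy (t + h))" "integrable M (noise_energy t)" using noise_energy_integrable t th by auto
  let ?c = "42 * \<kappa> * K\<^sup>2 * h\<^sup>2 + 4 * \<kappa> * \<epsilon> * h" and ?g = "\<kappa> * (1 / \<epsilon> + 16 * h)"
  \<comment> \<open>\<open>S \<omega>\<close> equals
    \<open>w (\<alpha> (t + h) \<omega>) \<omega>\<close>. The sum over \<open>j\<close> separates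
    the future state from quantities known at \<open>t\<close>, and conditioning then acts term by
    term.\<close>
  define S where "S \<omega> = (\<Sum>j\<in>UNIV. w j \<omega> * of_bool (\<alpha> (t + h) \<omega> = j))" for \<omega>
  have S: "integrable M S" "expectation S = (\<Sum>j\<in>UNIV. expectation (\<lambda>\<omega>. w j \<omega> * of_bool (\<alpha> (t + h) \<omega> = j)))"
    unfolding S_def
    by (simp_all only: Bochner_Integration.integrable_sum[OF w1] Bochner_Integration.integral_sum[OF w1])
  let ?R = "\<lambda>\<omega>. S \<omega> + 2 * h * m \<omega>
      + 4 * h * \<kappa> * K * (\<eta> \<omega> * ?D (t + h) \<omega>) + 4 * \<kappa> * K * (\<eta> \<omega> * time_away t h \<omega>)
      + ?c * \<eta> \<omega> + ?g * (noise_energy (t + h) \<omega> - noise_energy t \<omega>)"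
  have pointwise: "X x (t + h) \<omega> \<bullet> (P (\<alpha> (t + h) \<omega>) *v X x (t + h) \<omega>) \<le> ?R \<omega>" if "\<omega> \<in> space M" for \<omega>
  proof -
    have "S \<omega> = (\<Sum>j\<in>UNIV. if j = \<alpha> (t + h) \<omega> then w j \<omega> else 0)"
      unfolding S_def by (intro sum.cong) auto
    then have "S \<omega> = w (\<alpha> (t + h) \<omega>) \<omega>" by simp
    then show ?thesis
      using X_quadratic_step[where P=P and x=x and i="\<alpha> (t + h) \<omega>", OF that t h \<kappa> sym \<open>0 < \<epsilon>\<close>]
      unfolding w_def m_def \<eta>_def by (simp add: algebra_simps)
  qed
  have R_int: "integrable M ?R"
    by (intro Bochner_Integration.integrable_add integrable_mult_right
        Bochner_Integration.integrable_diff S m D_int J_int \<eta> noise_energy)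
  have "lyapunov P x (t + h) \<le> expectation ?R"
    unfolding lyapunov_def using pointwise by (intro integral_mono V_int[OF th int_next] R_int)
  also have "\<dots> = expectation S + 2 * h * expectation m
      + 4 * h * \<kappa> * K * expectation (\<lambda>\<omega>. \<eta> \<omega> * ?D (t + h) \<omega>) + 4 * \<kappa> * K * expectation (\<lambda>\<omega>. \<eta> \<omega> * time_away t h \<omega>)
      + ?c * expectation \<eta> + ?g * (expectation (noise_energy (t + h)) - expectation (noise_energy t))"
    by (simp add: S(1) m D_int J_int \<eta>(1) noise_energy)
  also have "expectation S = expectation ?pw"
    unfolding S(2) using expectation_transition[OF t _ w(2,1), of "t + h"] h w2
    by (simp add: Bochner_Integration.integral_sum)
  also have "expectation ?pw + 2 * h * expectation m = expectation (\<lambda>\<omega>. ?pw \<omega> + 2 * h * m \<omega>)"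
    by (simp add: Bochner_Integration.integrable_sum w2 m)
  also have "\<dots> \<le> expectation (\<lambda>\<omega>. X x t \<omega> \<bullet> (P (\<alpha> t \<omega>) *v X x t \<omega>) + h * (- \<delta> + real CARD('s) * \<kappa> * e) * \<eta> \<omega>)"
  proof (rule integral_mono)
    show "integrable M (\<lambda>\<omega>. ?pw \<omega> + 2 * h * m \<omega>)"
      by (intro Bochner_Integration.integrable_add Bochner_Integration.integrable_sum integrable_mult_right w2 m)
    show "integrable M (\<lambda>\<omega>. X x t \<omega> \<bullet> (P (\<alpha> t \<omega>) *v X x t \<omega>) + h * (- \<delta> + real CARD('s) * \<kappa> * e) * \<eta> \<omega>)"
      by (intro Bochner_Integration.integrable_add integrable_mult_right V_int t int \<eta>)
    fix \<omega>
    let ?i = "\<alpha> t \<omega>"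
    \<comment> \<open>Insertion of the expansion of \<open>p h\<close>. The sign of
      \<open>w j\<close> is unknown, so its absolute bound meets the absolute generator error;
      summing over \<open>j\<close> produces the factor \<open>CARD('s)\<close>.\<close>
    have "w j \<omega> * p h $ ?i $ j \<le> w j \<omega> * of_bool (?i = j) + h * (Q $ ?i $ j * w j \<omega>) + \<kappa> * e * h * \<eta> \<omega>" for j
    proof -
      have "w j \<omega> * (p h $ ?i $ j - of_bool (?i = j) - h * Q $ ?i $ j)
          \<le> \<bar>w j \<omega>\<bar> * \<bar>p h $ ?i $ j - of_bool (?i = j) - h * Q $ ?i $ j\<bar>"
        by (metis abs_ge_self abs_mult)
      also have "\<dots> \<le> (\<kappa> * \<eta> \<omega>) * (e * h)"
        using w_bound[of j \<omega>] gen[of ?i j] \<kappa>(1) \<eta>(3)[of \<omega>] by (intro mult_mono) auto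
      finally show ?thesis by (simp add: algebra_simps)
    qed
    then have "?pw \<omega> \<le> (\<Sum>j\<in>UNIV. w j \<omega> * of_bool (?i = j) + h * (Q $ ?i $ j * w j \<omega>) + \<kappa> * e * h * \<eta> \<omega>)"
      by (intro sum_mono) auto
    also have "\<dots> = (\<Sum>j\<in>UNIV. w j \<omega> * of_bool (?i = j)) + h * (\<Sum>j\<in>UNIV. Q $ ?i $ j * w j \<omega>)
        + real CARD('s) * (\<kappa> * e * h * \<eta> \<omega>)"
      by (simp add: sum.distrib sum_distrib_left)
    also have "(\<Sum>j\<in>UNIV. w j \<omega> * of_bool (?i = j)) = (\<Sum>j\<in>UNIV. if j = ?i then w j \<omega> else 0)"
      by (intro sum.cong) auto
    also have "\<dots> = w ?i \<omega>" by simp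
    finally have 1: "?pw \<omega> \<le> w ?i \<omega> + h * (\<Sum>j\<in>UNIV. Q $ ?i $ j * w j \<omega>) + real CARD('s) * (\<kappa> * e * h * \<eta> \<omega>)" .
    have "h * (2 * m \<omega> + (\<Sum>j\<in>UNIV. Q $ ?i $ j * w j \<omega>)) \<le> h * (- \<delta> * \<eta> \<omega>)"
      using neg[of ?i "X x t \<omega>"] h(1) by (intro mult_left_mono) (auto simp: m_def w_def \<eta>_def)
    with 1 show "?pw \<omega> + 2 * h * m \<omega> \<le> X x t \<omega> \<bullet> (P (\<alpha> t \<omega>) *v X x t \<omega>) + h * (- \<delta> + real CARD('s) * \<kappa> * e) * \<eta> \<omega>"
      by (simp add: w_def algebra_simps)
  qed
  also have "\<dots> = lyapunov P x t + h * (- \<delta> + real CARD('s) * \<kappa> * e) * expectation \<eta>"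
    using V_int[OF t int] \<eta>(1) by (simp add: lyapunov_def)
  \<comment> \<open>The jump probability bound is used twice: here for the state at the end of the
    step, next for the time spent away during the step. Each gives
    \<open>4 * \<kappa> * K * q * h\<^sup>2\<close>, hence the 8 of the statement.\<close>
  also have "4 * h * \<kappa> * K * expectation (\<lambda>\<omega>. \<eta> \<omega> * ?D (t + h) \<omega>) \<le> 4 * h * \<kappa> * K * (q * h * expectation \<eta>)"
    using D_le[of "t + h"] h \<kappa>(1) K_pos by (intro mult_left_mono) auto
  also have "4 * \<kappa> * K * expectation (\<lambda>\<omega>. \<eta> \<omega> * time_away t h \<omega>) \<le> 4 * \<kappa> * K * (h * (q * h * expectation \<eta>))"
    using J_le \<kappa>(1) K_pos by (intro mult_left_mono) auto
  finally show ?thesis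
    unfolding \<eta>_def by (simp add: algebra_simps power2_eq_square)
qed

end

section \<open>From bounds on the grid to square integrability in continuous time\<close>

context switched_linear_system
begin

lemma X_zero: "\<omega> \<in> space M \<Longrightarrow> X x 0 \<omega> = x"
  using X_solves[of \<omega> 0 x] set_borel_integral_eq_integral(2)[OF X_integrable[of \<omega> 0 0 x]] by simp

text \<open>On each cell the one-step bound replaces the square norm by a constant. Neighbouring
  closed cells share an end point, which is harmless for an upper bound.\<close>

lemma X_nn_integral_le_grid:
  assumes h: "0 < h" "2 * K * h \<le> 1" and w: "\<omega> \<in> space M"
  shows "(\<integral>\<^sup>+s\<in>{0..}. ennreal ((norm (X x s \<omega>))\<^sup>2) \<partial>lborel)
    \<le> (\<Sum>k. ennreal (h * (8 * ((norm (X x (real k * h) \<omega>))\<^sup>2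
            + h * (noise_energy (real k * h + h) \<omega> - noise_energy (real k * h) \<omega>)))))"
proof -
  define c where "c k = 8 * ((norm (X x (real k * h) \<omega>))\<^sup>2
            + h * (noise_energy (real k * h + h) \<omega> - noise_energy (real k * h) \<omega>))" for k
  let ?I = "\<lambda>k. {real k * h..real k * h + h}"
  have c: "(norm (X x s \<omega>))\<^sup>2 \<le> c k" if "s \<in> ?I k" for s k
    unfolding c_def using that h w by (intro X_square_step) auto
  have "(\<integral>\<^sup>+s\<in>{0..}. ennreal ((norm (X x s \<omega>))\<^sup>2) \<partial>lborel)
      \<le> (\<integral>\<^sup>+s. (\<Sum>k. ennreal (c k) * indicator (?I k) s) \<partial>lborel)"
  proof (intro nn_integral_mono)
    fix s :: real
    show "ennreal ((norm (X x s \<omega>))\<^sup>2) * indicator {0..} s \<le> (\<Sum>k. ennreal (c k) * indicator (?I k) s)"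
    proof (cases "0 \<le> s")
      case True
      define k where "k = nat \<lfloor>s / h\<rfloor>"
      have "real k \<le> s / h" "s / h \<le> real k + 1"
        using True h(1) unfolding k_def by (simp_all add: of_nat_nat)
      then have s: "s \<in> ?I k" using h(1) by (simp add: field_simps)
      have "ennreal ((norm (X x s \<omega>))\<^sup>2) \<le> (\<Sum>k\<in>{k}. ennreal (c k) * indicator (?I k) s)"
        using c[OF s] s by (simp add: ennreal_leI)
      also have "\<dots> \<le> (\<Sum>k. ennreal (c k) * indicator (?I k) s)"
        by (intro sum_le_suminf) auto
      finally show ?thesis using True by simp
    qed simp
  qed
  also have "\<dots> = (\<Sum>k. \<integral>\<^sup>+s. ennreal (c k) * indicator (?I k) s \<partial>lborel)"
    by (intro nn_integral_suminf) simp
  also have "\<dots> = (\<Sum>k. ennreal (h * c k))"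
  proof (intro suminf_cong)
    fix k
    have "0 \<le> c k" using c[of "real k * h" k] h(1) by (auto intro: order_trans[OF zero_le_power2])
    then show "(\<integral>\<^sup>+s. ennreal (c k) * indicator (?I k) s \<partial>lborel) = ennreal (h * c k)"
      using h(1) by (simp add: nn_integral_cmult_indicator ennreal_mult mult.commute)
  qed
  finally show ?thesis unfolding c_def .
qed

text \<open>After exchanging expectation and series, the partial sums consist of the assumed grid
  sum and a telescoping sum of expected energies. Both are bounded independently of the number of
  cells.\<close>

lemma X_L2_of_grid_bound:
  assumes h: "0 < h" "2 * K * h \<le> 1"
    and int: "\<And>k. integrable M (\<lambda>\<omega>. (norm (X x (real k * h) \<omega>))\<^sup>2)"
    and bound: "\<And>n. (\<Sum>k<n. expectation (\<lambda>\<omega>. (norm (X x (real k * h) \<omega>))\<^sup>2)) \<le> C"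
  shows "(\<integral>\<^sup>+\<omega>. (\<integral>\<^sup>+s\<in>{0..}. ennreal ((norm (X x s \<omega>))\<^sup>2) \<partial>lborel) \<partial>M) < \<infinity>"
proof -
  obtain CG where CG: "\<And>t. 0 \<le> t \<Longrightarrow> expectation (noise_energy t) \<le> CG" using noise_energy_expectation_bounded by blast
  define u where "u k = expectation (\<lambda>\<omega>. (norm (X x (real k * h) \<omega>))\<^sup>2)" for k :: nat
  define g where "g k = expectation (noise_energy (real k * h))" for k :: nat
  define c where "c k \<omega> = h * (8 * ((norm (X x (real k * h) \<omega>))\<^sup>2
            + h * (noise_energy (real k * h + h) \<omega> - noise_energy (real k * h) \<omega>)))" for k \<omega>
  have succ: "real k * h + h = real (Suc k) * h" for k by (simp add: algebra_simps)
  have noise_energy_int: "integrable M (noise_energy (real k * h))" for k using noise_energy_integrable h(1) by simp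
  have c_int: "integrable M (c k)" for k
    unfolding c_def succ
    by (intro integrable_mult_right Bochner_Integration.integrable_add Bochner_Integration.integrable_diff int noise_energy_int)
  have c_nonneg: "0 \<le> c k \<omega>" if "\<omega> \<in> space M" for k \<omega>
  proof -
    have "(norm (X x (real k * h) \<omega>))\<^sup>2 \<le> 8 * ((norm (X x (real k * h) \<omega>))\<^sup>2
            + h * (noise_energy (real k * h + h) \<omega> - noise_energy (real k * h) \<omega>))"
      using h that by (intro X_square_step) auto
    from order_trans[OF zero_le_power2 this] show ?thesis
      unfolding c_def by (rule mult_nonneg_nonneg[OF less_imp_le[OF h(1)]])
  qed
  have c_exp: "expectation (c k) = 8 * h * (u k + h * (g (Suc k) - g k))" for k
    unfolding c_def succ u_def g_def using int[of k] noise_energy_int[of k] noise_energy_int[of "Suc k"] by simp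
  have "(\<integral>\<^sup>+\<omega>. (\<integral>\<^sup>+s\<in>{0..}. ennreal ((norm (X x s \<omega>))\<^sup>2) \<partial>lborel) \<partial>M) \<le> (\<integral>\<^sup>+\<omega>. (\<Sum>k. ennreal (c k \<omega>)) \<partial>M)"
    unfolding c_def by (intro nn_integral_mono X_nn_integral_le_grid h)
  also have "\<dots> = (\<Sum>k. \<integral>\<^sup>+\<omega>. ennreal (c k \<omega>) \<partial>M)"
    using c_int by (intro nn_integral_suminf) auto
  also have "\<dots> = (\<Sum>k. ennreal (expectation (c k)))"
    using c_int c_nonneg by (intro suminf_cong nn_integral_eq_integral) auto
  also have "\<dots> = (SUP n. \<Sum>k<n. ennreal (expectation (c k)))"
    by (rule suminf_eq_SUP)
  also have "\<dots> \<le> ennreal (8 * h * (C + h * CG))"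
  proof (rule SUP_least)
    fix n
    have "0 \<le> expectation (c k)" for k using c_nonneg by (intro Bochner_Integration.integral_nonneg) auto
    then have "(\<Sum>k<n. ennreal (expectation (c k))) = ennreal (\<Sum>k<n. expectation (c k))"
      by (intro sum_ennreal) auto
    also have "(\<Sum>k<n. expectation (c k)) = 8 * h * ((\<Sum>k<n. u k) + h * (\<Sum>k<n. g (Suc k) - g k))"
      by (simp add: c_exp sum.distrib sum_distrib_left distrib_left)
    also have "\<dots> = 8 * h * ((\<Sum>k<n. u k) + h * (g n - g 0))" by (simp only: sum_lessThan_telescope)
    also have "\<dots> \<le> 8 * h * (C + h * CG)"
    proof -
      have "0 \<le> g 0" unfolding g_def by (intro Bochner_Integration.integral_nonneg noise_energy_nonneg)
      moreover have "g n \<le> CG" unfolding g_def using h(1) by (intro CG) simp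
      ultimately have "(\<Sum>k<n. u k) + h * (g n - g 0) \<le> C + h * CG"
        using bound[of n] h(1) unfolding u_def by (intro add_mono mult_left_mono) auto
      then show ?thesis using h(1) by (intro mult_left_mono) auto
    qed
    finally show "(\<Sum>k<n. ennreal (expectation (c k))) \<le> ennreal (8 * h * (C + h * CG))"
      by (simp add: ennreal_leI)
  qed
  finally show ?thesis by (rule le_less_trans) simp
qed

end

section \<open>Choice of the constants and summation along the grid\<close>

context markov_switched_linear_system
begin

lemma X_square_integrable_grid:
  assumes "0 < h" "2 * K * h \<le> 1"
  shows "integrable M (\<lambda>\<omega>. (norm (X x (real k * h) \<omega>))\<^sup>2)"
proof (induction k)
  case 0
  have "integrable M (\<lambda>\<omega>. (norm x)\<^sup>2)" by simp
  then show ?case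
    by (rule Bochner_Integration.integrable_cong[THEN iffD1, rotated 2]) (simp_all add: X_zero)
next
  case (Suc k)
  then show ?case
    using X_square_integrable_step[of "real k * h" h x] assms by (simp add: algebra_simps)
qed

text \<open>The negative term \<open>- \<delta>\<close> has to dominate all errors of
  \<open>lyapunov_step\<close>. Half of it is spent on them, and the remaining
  \<open>\<delta> / 2\<close> bounds the grid sum of the second moments.\<close>

lemma X_L2:
  assumes p0: "p 0 = mat 1"
    and gen: "\<And>e. 0 < e \<Longrightarrow> \<exists>h0>0. \<forall>h i j. 0 < h \<and> h \<le> h0 \<longrightarrow>
                \<bar>p h $ i $ j - of_bool (i = j) - h * Q $ i $ j\<bar> \<le> e * h"
    and \<kappa>: "0 < \<kappa>" "\<And>i v. norm (P i *v v) \<le> \<kappa> * norm v" and sym: "\<And>i. transpose (P i) = P i"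
    and nonneg: "\<And>i v. 0 \<le> v \<bullet> (P i *v v)"
    and \<delta>: "0 < \<delta>"
    and neg: "\<And>i v. 2 * ((P i *v v) \<bullet> (A i *v v)) + (\<Sum>j\<in>UNIV. Q $ i $ j * (v \<bullet> (P j *v v))) \<le> - \<delta> * (norm v)\<^sup>2"
  shows "(\<integral>\<^sup>+\<omega>. (\<integral>\<^sup>+s\<in>{0..}. ennreal ((norm (X x s \<omega>))\<^sup>2) \<partial>lborel) \<partial>M) < \<infinity>"
proof -
  define D where "D = real CARD('s)"
  have D: "0 < D" by (simp add: D_def)
  \<comment> \<open>\<epsilon> limits the Young term to \<open>\<delta> / 4\<close>, and
    \<open>e\<close> limits the generator error summed over all states to
    \<open>\<delta> / 8\<close>. The cap \<open>e \<le> 1\<close> makes the jump rate below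
    independent of \<open>e\<close>.\<close>
  define \<epsilon> e where "\<epsilon> = \<delta> / (16 * \<kappa>)" and "e = min 1 (\<delta> / (8 * D * \<kappa>))"
  have \<epsilon>: "0 < \<epsilon>" "4 * \<kappa> * \<epsilon> = \<delta> / 4" using \<delta> \<kappa>(1) by (simp_all add: \<epsilon>_def)
  have e: "0 < e" "e \<le> 1" using \<delta> \<kappa>(1) D by (simp_all add: e_def)
  have "D * \<kappa> * e \<le> D * \<kappa> * (\<delta> / (8 * D * \<kappa>))"
    using D \<kappa>(1) by (intro mult_left_mono) (auto simp: e_def)
  then have De: "D * \<kappa> * e \<le> \<delta> / 8" using D \<kappa>(1) by simp
  obtain h0 where h0: "0 < h0" "\<And>h i j. 0 < h \<Longrightarrow> h \<le> h0 \<Longrightarrow> \<bar>p h $ i $ j - of_bool (i = j) - h * Q $ i $ j\<bar> \<le> e * h"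
    using gen[OF e(1)] by blast
  \<comment> \<open>A common bound for the exit rates of all states; the added 1 absorbs the
    generator error \<open>e\<close>.\<close>
  define q where "q = (\<Sum>i\<in>UNIV. \<bar>Q $ i $ i\<bar>) + 1"
  have q: "0 < q" "\<And>i. \<bar>Q $ i $ i\<bar> + 1 \<le> q"
    using abs_le_sum_abs[of "\<lambda>i. Q $ i $ i"] by (auto simp: q_def intro!: add_nonneg_pos sum_nonneg)
  define L where "L = 8 * \<kappa> * K * q + 42 * \<kappa> * K\<^sup>2"
  have L: "0 < L" using \<kappa>(1) K_pos q(1) by (simp add: L_def add_pos_pos)
  \<comment> \<open>The three caps make the generator expansion valid, make the pathwise step
    estimates applicable, and keep the errors with an additional factor \<open>h\<close>, collected
    in \<open>L\<close>, below \<open>\<delta> / 8\<close>.\<close>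
  define h where "h = min h0 (min (1 / (2 * K)) (\<delta> / (8 * L)))"
  have h: "0 < h" "h \<le> h0" "h \<le> 1 / (2 * K)" "h \<le> \<delta> / (8 * L)"
    using h0(1) K_pos \<delta> L by (auto simp: h_def)
  have hK: "2 * K * h \<le> 1" using h(3) K_pos by (simp add: field_simps)
  have hL: "L * h \<le> \<delta> / 8" using h(4) L by (simp add: field_simps)
  \<comment> \<open>The expansion is available only for positive times, so \<open>s = 0\<close> is
    settled by \<open>p 0 = mat 1\<close>.\<close>
  have jump: "1 - p s $ i $ i \<le> q * h" if "0 \<le> s" "s \<le> h" for s i
  proof (cases "s = 0")
    case True
    then show ?thesis using p0 q(1) h(1) by (simp add: mat_def)
  next
    case False
    have "1 - p s $ i $ i \<le> e * s - s * Q $ i $ i" using h0(2)[of s i i] that h(2) False by simp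
    also have "\<dots> \<le> s * (\<bar>Q $ i $ i\<bar> + 1)"
      using mult_left_mono[of "e - Q $ i $ i" "\<bar>Q $ i $ i\<bar> + 1" s] e(2) that
      by (simp add: algebra_simps abs_le_iff)
    also have "\<dots> \<le> h * q" using that q by (intro mult_mono) auto
    finally show ?thesis by (simp add: mult.commute)
  qed
  define u where "u k = expectation (\<lambda>\<omega>. (norm (X x (real k * h) \<omega>))\<^sup>2)" for k :: nat
  define g where "g k = expectation (noise_energy (real k * h))" for k :: nat
  define v where "v k = lyapunov P x (real k * h)" for k :: nat
  define C where "C = \<kappa> * (1 / \<epsilon> + 16 * h)"
  have C: "0 < C" using \<kappa>(1) \<epsilon>(1) h(1) by (simp add: C_def add_pos_pos)
  have int: "integrable M (\<lambda>\<omega>. (norm (X x (real k * h) \<omega>))\<^sup>2)" for k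
    by (rule X_square_integrable_grid[OF h(1) hK])
  have step: "h * (\<delta> / 2) * u k \<le> v k - v (Suc k) + C * (g (Suc k) - g k)" for k
  proof -
    have eq: "real k * h + h = real (Suc k) * h" by (simp add: algebra_simps)
    let ?B = "- \<delta> + real CARD('s) * \<kappa> * e + 8 * \<kappa> * K * q * h + 42 * \<kappa> * K\<^sup>2 * h + 4 * \<kappa> * \<epsilon>"
    have "v (Suc k) \<le> v k + h * ?B * u k + C * (g (Suc k) - g k)"
      unfolding v_def u_def g_def C_def eq[symmetric]
      using h(1) e(1) h0(2)[OF h(1,2)]
      by (intro lyapunov_step[where Q=Q] hK int \<kappa> sym \<epsilon>(1) jump neg) auto
    \<comment> \<open>The shares of the errors are \<open>\<delta> / 8\<close> for the generator,
      \<open>\<delta> / 8\<close> for \<open>L * h\<close> and \<open>\<delta> / 4\<close> for the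
      Young term.\<close>
    moreover have "?B \<le> - (\<delta> / 2)" using De hL \<epsilon>(2) by (simp add: D_def L_def algebra_simps)
    then have "h * ?B * u k \<le> h * (- (\<delta> / 2)) * u k"
      using h(1) by (intro mult_right_mono mult_left_mono) (auto simp: u_def)
    ultimately show ?thesis by simp
  qed
  obtain CG where CG: "\<And>t. 0 \<le> t \<Longrightarrow> expectation (noise_energy t) \<le> CG" using noise_energy_expectation_bounded by blast
  have "(\<Sum>k<n. u k) \<le> (v 0 + C * CG) / (h * (\<delta> / 2))" for n
  proof -
    have "h * (\<delta> / 2) * (\<Sum>k<n. u k) \<le> (\<Sum>k<n. v k - v (Suc k) + C * (g (Suc k) - g k))"
      unfolding sum_distrib_left by (intro sum_mono step)
    also have "\<dots> = v 0 - v n + C * (g n - g 0)"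
      by (simp only: sum.distrib sum_distrib_left[symmetric] sum_lessThan_telescope sum_lessThan_telescope')
    also have "\<dots> \<le> v 0 + C * CG"
    proof -
      \<comment> \<open>Positivity of the forms lets the final value of the telescoped sum be
        dropped, so the bound is uniform in \<open>n\<close>.\<close>
      have "0 \<le> v n" unfolding v_def lyapunov_def by (intro Bochner_Integration.integral_nonneg nonneg)
      moreover have "0 \<le> g 0" unfolding g_def by (intro Bochner_Integration.integral_nonneg noise_energy_nonneg)
      moreover have "g n \<le> CG" unfolding g_def using h(1) by (intro CG) simp
      ultimately have "C * (g n - g 0) \<le> C * CG" "0 \<le> v n" using C by (auto intro!: mult_left_mono)
      then show ?thesis by simp
    qed
    finally show ?thesis using h(1) \<delta> by (simp add: pos_le_divide_eq mult.commute)
  qed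
  then show ?thesis
    unfolding u_def by (rule X_L2_of_grid_bound[OF h(1) hK int])
qed

end

section \<open>Existence and uniqueness in L2\<close>

text \<open>The sum of the operator norms serves all states at once; adding 1 makes it strictly
  positive even if every matrix is zero.\<close>

lemma finite_family_matrix_bound:
  fixes B :: "'s::finite \<Rightarrow> real^'n^'n"
  obtains K where "0 < K" "\<And>i v. norm (B i *v v) \<le> K * norm v"
proof
  let ?o = "\<lambda>i. onorm ((*v) (B i))"
  have pos: "0 \<le> ?o i" for i by (intro onorm_pos_le matrix_vector_mul_bounded_linear)
  then show "0 < (\<Sum>i\<in>UNIV. ?o i) + 1" by (intro add_nonneg_pos sum_nonneg) auto
  fix i v
  have "norm (B i *v v) \<le> ?o i * norm v" by (intro onorm matrix_vector_mul_bounded_linear)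
  also have "?o i \<le> (\<Sum>i\<in>UNIV. ?o i) + 1" using member_le_sum[of i UNIV ?o] pos by simp
  then have "?o i * norm v \<le> ((\<Sum>i\<in>UNIV. ?o i) + 1) * norm v" by (rule mult_right_mono) simp
  finally show "norm (B i *v v) \<le> ((\<Sum>i\<in>UNIV. ?o i) + 1) * norm v" .
qed

text \<open>The form attains a positive minimum on the compact unit sphere; homogeneity of degree
  two carries this over to all vectors.\<close>

lemma pos_def_coercive:
  fixes B :: "real^'n^'n"
  assumes "pos_def B"
  obtains d where "0 < d" "\<And>v. d * (norm v)\<^sup>2 \<le> v \<bullet> (B *v v)"
proof -
  let ?f = "\<lambda>v. v \<bullet> (B *v v)"
  have "continuous_on (sphere 0 1) ?f"
    by (intro continuous_intros matrix_vector_mult_linear_continuous_on)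
  moreover have "sphere (0 :: real^'n) 1 \<noteq> {}" by simp
  ultimately obtain w where w: "w \<in> sphere 0 1" "\<And>v. v \<in> sphere 0 1 \<Longrightarrow> ?f w \<le> ?f v"
    using continuous_attains_inf[of "sphere 0 1" ?f] by auto
  have "?f w * (norm v)\<^sup>2 \<le> ?f v" for v
  proof (cases "v = 0")
    case False
    let ?u = "v /\<^sub>R norm v"
    have "?f w \<le> ?f ?u" using False by (intro w(2)) simp
    also have "?f ?u = ?f v / (norm v)\<^sup>2"
      by (simp add: matrix_vector_mult_scaleR power2_eq_square divide_inverse)
    finally show ?thesis using False by (simp add: field_simps)
  qed simp
  moreover have "0 < ?f w" using assms w(1) unfolding pos_def_def by (metis dist_0_norm mem_sphere norm_zero zero_neq_one)
  ultimately show ?thesis using that by blast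
qed

lemma sum_matrix_vector_mult:
  fixes B :: "'s \<Rightarrow> real^'n^'m"
  shows "(\<Sum>j\<in>S. B j) *v v = (\<Sum>j\<in>S. B j *v v)"
  by (induction S rule: infinite_finite_induct) (auto simp: matrix_vector_mult_add_rdistrib)

text \<open>Symmetry of \<open>P i\<close> makes the contributions of \<open>P i ** B\<close> and of
  its transpose coincide. This links the matrix inequality with the drift term of the Lyapunov
  step.\<close>

lemma lyapunov_quadratic_form:
  fixes P :: "'s::finite \<Rightarrow> real^'n^'n"
  assumes "\<And>i. transpose (P i) = P i"
  shows "v \<bullet> ((P i ** B + transpose B ** P i + (\<Sum>j\<in>UNIV. q j *\<^sub>R P j)) *v v)
     = 2 * ((P i *v v) \<bullet> (B *v v)) + (\<Sum>j\<in>UNIV. q j * (v \<bullet> (P j *v v)))"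
proof -
  have "v \<bullet> ((P i ** B) *v v) = (P i *v v) \<bullet> (B *v v)"
    by (metis assms dot_lmul_matrix matrix_vector_mul_assoc transpose_matrix_vector)
  moreover have "v \<bullet> ((transpose B ** P i) *v v) = (P i *v v) \<bullet> (B *v v)"
    by (metis dot_lmul_matrix inner_commute matrix_vector_mul_assoc transpose_matrix_vector)
  ultimately show ?thesis
    by (simp add: matrix_vector_mult_add_rdistrib inner_add sum_matrix_vector_mult inner_sum_right
        scaleR_matrix_vector_assoc[symmetric])
qed

text \<open>Each entry is dominated by the matrix norm, so convergence of the difference quotient
  gives one \<open>h0\<close> for all entries. Halving \<open>c\<close> allows a non-strict bound on
  \<open>h\<close>.\<close>

lemma has_generatorD:
  fixes Q :: "real^'s^'s"
  assumes "has_generator p Q" "0 < e"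
  shows "\<exists>h0>0. \<forall>h i j. 0 < h \<and> h \<le> h0 \<longrightarrow> \<bar>p h $ i $ j - of_bool (i = j) - h * Q $ i $ j\<bar> \<le> e * h"
proof -
  have "\<forall>\<^sub>F h in at_right 0. dist ((p h - mat 1) /\<^sub>R h) Q < e"
    using assms unfolding has_generator_def by (rule tendstoD)
  then obtain c where c: "0 < c" "\<And>h. 0 < h \<Longrightarrow> h < c \<Longrightarrow> dist ((p h - mat 1) /\<^sub>R h) Q < e"
    unfolding eventually_at_right_field by auto
  have "\<bar>p h $ i $ j - of_bool (i = j) - h * Q $ i $ j\<bar> \<le> e * h" if "0 < h" "h \<le> c / 2" for h i j
  proof -
    let ?E = "(p h - mat 1) /\<^sub>R h - Q"
    have "\<bar>?E $ i $ j\<bar> \<le> norm ?E"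
      by (rule order_trans[OF component_le_norm_cart Finite_Cartesian_Product.norm_nth_le])
    also have "\<dots> < e" using c(2)[of h] that c(1) by (simp add: dist_norm)
    finally have "h * \<bar>?E $ i $ j\<bar> \<le> h * e" using that by simp
    moreover have "h * ?E $ i $ j = p h $ i $ j - of_bool (i = j) - h * Q $ i $ j"
      using that by (simp add: mat_def algebra_simps)
    ultimately show ?thesis using that by (metis abs_mult abs_of_pos mult.commute)
  qed
  then show ?thesis using c(1) by (intro exI[of _ "c / 2"]) auto
qed

lemma prog_measurable_mask:
  assumes "prog_measurable_to F borel \<phi>" "\<And>t. 0 \<le> t \<Longrightarrow> N \<in> sets (F t)"
  shows "prog_measurable_to F borel (\<lambda>t \<omega>. if \<omega> \<in> N then 0 else \<phi> t \<omega>)"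
  unfolding prog_measurable_to_def
proof (intro allI impI)
  fix t :: real assume t: "0 \<le> t"
  let ?S = "restrict_space borel {0..t} \<Otimes>\<^sub>M F t"
  have "snd -` N \<inter> space ?S \<in> sets ?S" using assms(2)[OF t] by (intro measurable_sets[OF measurable_snd])
  moreover have "snd -` N \<inter> space ?S = {x \<in> space ?S. snd x \<in> N}" by auto
  ultimately have "{x \<in> space ?S. snd x \<in> N} \<in> sets ?S" by simp
  moreover have "(\<lambda>x. \<phi> (fst x) (snd x)) \<in> borel_measurable ?S"
    using assms(1) t unfolding prog_measurable_to_def case_prod_beta' by blast
  ultimately show "(\<lambda>(t, \<omega>). if \<omega> \<in> N then 0 else \<phi> t \<omega>) \<in> borel_measurable ?S"
    unfolding case_prod_beta' by (intro measurable_If) auto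
qed

text \<open>A finite integral forces almost everywhere finiteness only for a measurable integrand;
  the work lies in showing that the energy of a path is a measurable function of \<omega>.\<close>

lemma AE_square_integrable_path:
  fixes b :: "real \<Rightarrow> 'w \<Rightarrow> 'b::{second_countable_topology, real_normed_vector}"
  assumes "sigma_finite_measure M" and "prog_measurable_to F borel b"
    and "\<And>t. 0 \<le> t \<Longrightarrow> (\<lambda>\<omega>. \<omega>) \<in> measurable M (F t)"
    and fin: "(\<integral>\<^sup>+\<omega>. (\<integral>\<^sup>+s\<in>{0..}. ennreal ((norm (b s \<omega>))\<^sup>2) \<partial>lborel) \<partial>M) < \<infinity>"
  shows "AE \<omega> in M. (\<integral>\<^sup>+s\<in>{0..}. ennreal ((norm (b s \<omega>))\<^sup>2) \<partial>lborel) < \<infinity>"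
proof -
  have "(\<lambda>x. b (max 0 (snd x)) (fst x)) \<in> borel_measurable (M \<Otimes>\<^sub>M lborel)"
    using measurable_compose[OF measurable_pair_swap' prog_measurable_joint[OF assms(2,3)]]
    by (simp add: case_prod_beta cong: measurable_cong_sets)
  then have "(\<lambda>x. ennreal ((norm (b (max 0 (snd x)) (fst x)))\<^sup>2) * indicator {0..} (snd x))
      \<in> borel_measurable (M \<Otimes>\<^sub>M lborel)" by measurable
  then have "(\<lambda>\<omega>. \<integral>\<^sup>+s. ennreal ((norm (b (max 0 s) \<omega>))\<^sup>2) * indicator {0..} s \<partial>lborel) \<in> borel_measurable M"
    by (intro lborel.borel_measurable_nn_integral) (simp add: case_prod_beta)
  moreover have "(\<integral>\<^sup>+s. ennreal ((norm (b (max 0 s) \<omega>))\<^sup>2) * indicator {0..} s \<partial>lborel)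
      = (\<integral>\<^sup>+s\<in>{0..}. ennreal ((norm (b s \<omega>))\<^sup>2) \<partial>lborel)" for \<omega>
    by (intro nn_integral_cong) (auto simp: indicator_def max_def)
  ultimately have "(\<lambda>\<omega>. \<integral>\<^sup>+s\<in>{0..}. ennreal ((norm (b s \<omega>))\<^sup>2) \<partial>lborel) \<in> borel_measurable M"
    by simp
  from nn_integral_PInf_AE[OF this] show ?thesis
    using fin by (auto simp: top.not_eq_extremum less_top elim: eventually_mono)
qed

theorem proposition1:
  fixes M :: "'w measure"
    and \<alpha> :: "real \<Rightarrow> 'w \<Rightarrow> 's::finite"
    and p :: "real \<Rightarrow> real^'s^'s"
    and Q :: "real^'s^'s"
    and A :: "'s \<Rightarrow> real^'n^'n"
    and b :: "real \<Rightarrow> 'w \<Rightarrow> real^'n"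
  assumes "prob_space M" and "complete_measure M"
    and "markov_chain M (augmented_filtration M \<alpha>) \<alpha> p" and "irreducible_semigroup p"
    and "q_matrix Q" and "has_generator p Q"
    and "\<exists>P :: 's \<Rightarrow> real^'n^'n.
           (\<forall>i. pos_def (P i)) \<and>
           (\<forall>i. neg_def (P i ** A i + transpose (A i) ** P i + (\<Sum>j\<in>UNIV. Q $ i $ j *\<^sub>R P j)))"
    and "b \<in> L2_F M (augmented_filtration M \<alpha>)"
  shows "\<forall>x i. (AE \<omega> in M. \<alpha> 0 \<omega> = i) \<longrightarrow>
           (\<exists>X \<in> L2_F M (augmented_filtration M \<alpha>). solves_system M \<alpha> A b x X \<and>
              (\<forall>Y \<in> L2_F M (augmented_filtration M \<alpha>). solves_system M \<alpha> A b x Y \<longrightarrow>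
                 (AE \<omega> in M. \<forall>t\<ge>0. Y t \<omega> = X t \<omega>)))"
proof (intro allI impI)
  fix x :: "real^'n" and i
  let ?F = "augmented_filtration M \<alpha>"
  interpret prob_space M by fact
  note mc = assms(3)[unfolded markov_chain_def]
  have \<alpha>_meas: "\<alpha> t \<in> measurable M (count_space UNIV)" if "0 \<le> t" for t using mc that by blast
  have sub: "subalgebra M (?F t)" for t
    using augmented_filtration_subset[OF \<alpha>_meas] by (auto simp: subalgebra_def)
  have ident: "(\<lambda>\<omega>. \<omega>) \<in> measurable M (?F t)" for t
    by (rule measurable_from_subalg[OF sub]) (auto intro: measurable_ident_sets)
  have b_prog: "prog_measurable_to ?F borel b"
    and b_L2: "(\<integral>\<^sup>+\<omega>. (\<integral>\<^sup>+s\<in>{0..}. ennreal ((norm (b s \<omega>))\<^sup>2) \<partial>lborel) \<partial>M) < \<infinity>"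
    using assms(8) by (auto simp: L2_F_def progressively_measurable_iff)
  have "AE \<omega> in M. cadlag_path (\<lambda>t. \<alpha> t \<omega>)" using mc by blast
  moreover have "AE \<omega> in M. (\<integral>\<^sup>+s\<in>{0..}. ennreal ((norm (b s \<omega>))\<^sup>2) \<partial>lborel) < \<infinity>"
    by (rule AE_square_integrable_path[OF _ b_prog ident b_L2]) unfold_locales
  ultimately have "AE \<omega> in M. cadlag_path (\<lambda>t. \<alpha> t \<omega>) \<and>
      (\<integral>\<^sup>+s\<in>{0..}. ennreal ((norm (b s \<omega>))\<^sup>2) \<partial>lborel) < \<infinity>"
    by eventually_elim simp
  then obtain N where N: "N \<in> null_sets M"
    and good: "\<And>\<omega>. \<omega> \<in> space M \<Longrightarrow> \<omega> \<notin> N \<Longrightarrow> cadlag_path (\<lambda>t. \<alpha> t \<omega>)"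
      "\<And>\<omega>. \<omega> \<in> space M \<Longrightarrow> \<omega> \<notin> N \<Longrightarrow> (\<integral>\<^sup>+s\<in>{0..}. ennreal ((norm (b s \<omega>))\<^sup>2) \<partial>lborel) < \<infinity>"
    unfolding eventually_ae_filter by blast
  have AE_N: "AE \<omega> in M. \<omega> \<notin> N" using N by (rule AE_not_in)
  have N_F: "N \<in> sets (?F t)" for t by (rule null_sets_in_augmented_filtration) fact
  \<comment> \<open>Null sets belong to every \<open>?F t\<close>, so modifying the data on \<open>N\<close> preserves adaptedness.\<close>
  define \<alpha>' where "\<alpha>' t \<omega> = (if \<omega> \<in> N then undefined else \<alpha> t \<omega>)" for t \<omega>
  define b' where "b' t \<omega> = (if \<omega> \<in> N then 0 else b t \<omega>)" for t \<omega>
  obtain K where K: "0 < K" "\<And>i v. norm (A i *v v) \<le> K * norm v"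
    by (rule finite_family_matrix_bound[of A]) (rule that)
  have \<alpha>'_adapted: "\<alpha>' s \<in> measurable (?F t) (count_space UNIV)" if "0 \<le> s" "s \<le> t" for s t
  proof -
    have "{\<omega> \<in> space (?F t). \<omega> \<in> N} \<in> sets (?F t)"
      using N_F[of t] sets.sets_into_space[OF N_F[of t]] by (simp add: Int_def[symmetric] inf.absorb2 Collect_conj_eq)
    then show ?thesis
      unfolding \<alpha>'_def[abs_def] using adapted_augmented_filtration[OF that, of \<alpha> M]
      by (intro measurable_If) auto
  qed
  interpret markov_switched_linear_system M ?F \<alpha>' A b' K p
  proof unfold_locales
    show "subalgebra M (?F t)" for t by (rule sub)
    show "prog_measurable_to ?F (count_space UNIV) \<alpha>'"
    proof (rule prog_measurable_right_continuous[OF \<alpha>'_adapted])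
      \<comment> \<open>On \<open>N\<close> the modified path is constant in time, hence trivially
        right-continuous.\<close>
      show "\<forall>\<^sub>F s in at_right t. \<alpha>' s \<omega> = \<alpha>' t \<omega>" if "0 \<le> t" "\<omega> \<in> space (?F t)" for t \<omega>
        using good(1)[of \<omega>] that by (cases "\<omega> \<in> N") (auto simp: \<alpha>'_def cadlag_path_def)
    qed auto
    show "prog_measurable_to ?F borel b'"
      unfolding b'_def[abs_def] by (rule prog_measurable_mask[OF b_prog N_F])
    show "(\<integral>\<^sup>+s\<in>{0..}. ennreal ((norm (b' s \<omega>))\<^sup>2) \<partial>lborel) < \<infinity>" if "\<omega> \<in> space M" for \<omega>
      using good(2)[OF that] by (cases "\<omega> \<in> N") (auto simp: b'_def)
    have "(\<integral>\<^sup>+\<omega>. (\<integral>\<^sup>+s\<in>{0..}. ennreal ((norm (b' s \<omega>))\<^sup>2) \<partial>lborel) \<partial>M)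
        \<le> (\<integral>\<^sup>+\<omega>. (\<integral>\<^sup>+s\<in>{0..}. ennreal ((norm (b s \<omega>))\<^sup>2) \<partial>lborel) \<partial>M)"
      by (intro nn_integral_mono mult_right_mono) (auto simp: b'_def)
    then show "(\<integral>\<^sup>+\<omega>. (\<integral>\<^sup>+s\<in>{0..}. ennreal ((norm (b' s \<omega>))\<^sup>2) \<partial>lborel) \<partial>M) < \<infinity>"
      using b_L2 by (rule le_less_trans)
    show "0 < K" "norm (A i *v v) \<le> K * norm v" for i v by (fact K)+
    show "AE \<omega> in M. real_cond_exp M (?F s) (indicator {\<omega> \<in> space M. \<alpha>' t \<omega> = j}) \<omega> = p (t - s) $ \<alpha>' s \<omega> $ j"
      if st: "0 \<le> s" "s \<le> t" for s t j
    proof -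
      interpret F: finite_measure_subalgebra M "?F s" by standard (rule sub)
      have "0 \<le> t" using st by simp
      have meas: "{\<omega> \<in> space M. \<gamma> \<omega> = j} \<in> sets M" if "\<gamma> \<in> measurable M (count_space UNIV)" for \<gamma>
        using measurable_sets[OF that, of "{j}"] by (simp add: vimage_def Int_def conj_commute)
      have "\<alpha>' t \<in> measurable M (count_space UNIV)"
        using measurable_from_subalg[OF sub \<alpha>'_adapted[OF \<open>0 \<le> t\<close> order_refl]] .
      note meas' = borel_measurable_indicator[OF meas[OF this]]
        borel_measurable_indicator[OF meas[OF \<alpha>_meas[OF \<open>0 \<le> t\<close>]]]
      \<comment> \<open>The two indicators differ only on \<open>N\<close>, so their conditional
        expectations agree almost surely and the Markov property transfers to
        \<open>\<alpha>'\<close>.\<close>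
      have "AE \<omega> in M. indicator {\<omega> \<in> space M. \<alpha>' t \<omega> = j} \<omega>
          = (indicator {\<omega> \<in> space M. \<alpha> t \<omega> = j} \<omega> :: real)"
        using AE_N by eventually_elim (simp add: \<alpha>'_def indicator_def)
      then have "AE \<omega> in M. real_cond_exp M (?F s) (indicator {\<omega> \<in> space M. \<alpha>' t \<omega> = j}) \<omega>
          = real_cond_exp M (?F s) (indicator {\<omega> \<in> space M. \<alpha> t \<omega> = j}) \<omega>"
        using meas' by (rule F.real_cond_exp_cong)
      moreover have "AE \<omega> in M. real_cond_exp M (?F s) (indicator {\<omega> \<in> space M. \<alpha> t \<omega> = j}) \<omega> = p (t - s) $ \<alpha> s \<omega> $ j"
        using mc st by blast
      ultimately show ?thesis
        using AE_N by eventually_elim (simp add: \<alpha>'_def)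
    qed
  qed
  obtain P where P: "\<And>i. pos_def (P i)"
    and neg: "\<And>i. neg_def (P i ** A i + transpose (A i) ** P i + (\<Sum>j\<in>UNIV. Q $ i $ j *\<^sub>R P j))"
    using assms(7) by blast
  have sym: "transpose (P i) = P i" for i using P by (simp add: pos_def_def)
  have nonneg: "0 \<le> v \<bullet> (P i *v v)" for i v
    using P[of i] by (cases "v = 0") (auto simp: pos_def_def less_imp_le)
  obtain \<kappa> where \<kappa>: "0 < \<kappa>" "\<And>i v. norm (P i *v v) \<le> \<kappa> * norm v"
    by (rule finite_family_matrix_bound[of P]) (rule that)
  let ?L = "\<lambda>i v. 2 * ((P i *v v) \<bullet> (A i *v v)) + (\<Sum>j\<in>UNIV. Q $ i $ j * (v \<bullet> (P j *v v)))"
  have "\<forall>i. \<exists>d. 0 < d \<and> (\<forall>v. d * (norm v)\<^sup>2 \<le> - ?L i v)"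
  proof
    fix i
    obtain d where d: "0 < d" "\<And>v. d * (norm v)\<^sup>2 \<le> v \<bullet> (- (P i ** A i + transpose (A i) ** P i + (\<Sum>j\<in>UNIV. Q $ i $ j *\<^sub>R P j)) *v v)"
      by (rule pos_def_coercive[OF neg[of i, unfolded neg_def_def]]) (rule that)
    have minus: "- B *v v = - (B *v v)" for B :: "real^'n^'n" and v
      by (simp add: matrix_vector_mult_def vec_eq_iff sum_negf)
    have "v \<bullet> (- (P i ** A i + transpose (A i) ** P i + (\<Sum>j\<in>UNIV. Q $ i $ j *\<^sub>R P j)) *v v) = - ?L i v" for v
      by (simp only: minus inner_minus_right lyapunov_quadratic_form[of P, OF sym])
    with d show "\<exists>d. 0 < d \<and> (\<forall>v. d * (norm v)\<^sup>2 \<le> - ?L i v)" by auto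
  qed
  from choice[OF this] obtain d where d: "\<And>i. 0 < d i" "\<And>i v. d i * (norm v)\<^sup>2 \<le> - ?L i v" by blast
  \<comment> \<open>Each state has its own decay constant \<open>d i\<close>; since there are
    finitely many states, the minimum is positive and serves all of them.\<close>
  define \<delta> where "\<delta> = Min (range d)"
  have \<delta>: "0 < \<delta>" "\<And>i. \<delta> \<le> d i" using d(1) by (auto simp: \<delta>_def)
  have "?L i v \<le> - \<delta> * (norm v)\<^sup>2" for i v
    using d(2)[of i v] mult_right_mono[OF \<delta>(2)[of i], of "(norm v)\<^sup>2"] by simp
  moreover have "p 0 = mat 1" using mc by (simp add: transition_semigroup_def)
  ultimately have "(\<integral>\<^sup>+\<omega>. (\<integral>\<^sup>+s\<in>{0..}. ennreal ((norm (X x s \<omega>))\<^sup>2) \<partial>lborel) \<partial>M) < \<infinity>"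
    by (intro X_L2[where Q=Q and P=P and \<kappa>=\<kappa> and \<delta>=\<delta>] has_generatorD[OF assms(6)] \<kappa> sym nonneg \<delta>(1))
  then have "X x \<in> L2_F M ?F"
    using X_prog[of x] by (simp add: L2_F_def progressively_measurable_iff)
  moreover have "solves_system M \<alpha> A b x (X x)"
    unfolding solves_system_def
    using AE_N AE_space
  proof eventually_elim
    case (elim \<omega>)
    \<comment> \<open>Off \<open>N\<close> the modified data are the original ones, so the pathwise
      statements about \<open>drift\<close> speak of the given system.\<close>
    then have "drift \<omega> s u = A (\<alpha> s \<omega>) *v u + b s \<omega>" for s u by (simp add: \<alpha>'_def b'_def)
    then show ?case
      using X_integrable[OF elim(2), of 0 _ x] X_solves[OF elim(2), of _ x] by simp
  qed
  moreover have "AE \<omega> in M. \<forall>t\<ge>0. Y t \<omega> = X x t \<omega>" if "solves_system M \<alpha> A b x Y" for Y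
    using that[unfolded solves_system_def] AE_N AE_space
  proof eventually_elim
    case (elim \<omega>)
    then have "drift \<omega> s u = A (\<alpha> s \<omega>) *v u + b s \<omega>" for s u by (simp add: \<alpha>'_def b'_def)
    then show ?case
      using elim(1) by (intro allI impI X_unique[OF elim(3)]) simp_all
  qed
  ultimately show "\<exists>X \<in> L2_F M ?F. solves_system M \<alpha> A b x X \<and>
      (\<forall>Y \<in> L2_F M ?F. solves_system M \<alpha> A b x Y \<longrightarrow> (AE \<omega> in M. \<forall>t\<ge>0. Y t \<omega> = X t \<omega>))"
    by blast
qed

end
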